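(* For every odd prime $\ell$ there are rational functions $f,g\in\mathbb{C}(z)$, both of degree $\ell$, such that (a) $f(g(z))\in\mathbb{R}(z)$; (b) $g:\hat{\mathbb{R}}\to\hat{\mathbb{C}}$ is injective, so $g(\hat{\mathbb{R}})$ is a Jordan curve; (c) $g(\hat{\mathbb{R}})$ is not a circle.
   Context: $\hat{\mathbb{C}}=\mathbb{C}\cup\{\infty\}$ is the Riemann sphere and $\hat{\mathbb{R}}=\mathbb{R}\cup\{\infty\}\subset\hat{\mathbb{C}}$. Rational functions are regarded as maps $\hat{\mathbb{C}}\to\hat{\mathbb{C}}$; the degree of a rational function $p/q$ with $p,q$ relatively prime polynomials is $\max(\deg p,\deg q)$. A circle in $\hat{\mathbb{C}}$ is either a usual circle in $\mathbb{C}$ or a line in $\hat{\mathbb{C}}$ (including the point $\infty$); equivalently, a set of the form $\lambda(\hat{\mathbb{R}})$ where $\lambda(z)=\frac{az+b}{cz+d}\in\mathbb{C}(z)$ with $ad-bc\neq0$. *)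

theory Defs
  imports
    "HOL-Analysis.Analysis"
    "HOL-Computational_Algebra.Computational_Algebra"
    "HOL-Computational_Algebra.Field_as_Ring"
begin

text \<open>The Riemann sphere is the one-point compactification of the complex plane: its points are
  the values of type \<^typ>\<open>complex option\<close>, with \<^term>\<open>None\<close> as the point at infinity.\<close>

abbreviation riemann_sphere :: "complex option topology" where
  "riemann_sphere \<equiv> Alexandroff_compactification (euclidean :: complex topology)"

definition real_circle :: "complex option set" where
  "real_circle = insert None (Some ` \<real>)"

text \<open>The field of rational functions over the complex numbers is \<^typ>\<open>complex poly fract\<close>, and
  \<^const>\<open>quot_of_fract\<close> yields the representation by coprime polynomials with monic denominator.\<close>

definition ratfun_num :: "complex poly fract \<Rightarrow> complex poly" where
  "ratfun_num r = fst (quot_of_fract r)"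

definition ratfun_den :: "complex poly fract \<Rightarrow> complex poly" where
  "ratfun_den r = snd (quot_of_fract r)"

definition ratfun_degree :: "complex poly fract \<Rightarrow> nat" where
  "ratfun_degree r = max (degree (ratfun_num r)) (degree (ratfun_den r))"

text \<open>The value at infinity is read off from the coefficients of degree \<open>n = ratfun_degree r\<close>:
  it is the ratio of the homogenizations of numerator and denominator to degree \<open>n\<close> at \<open>[1 : 0]\<close>.\<close>

fun ratfun_map :: "complex poly fract \<Rightarrow> complex option \<Rightarrow> complex option" where
  "ratfun_map r (Some z) =
    (if poly (ratfun_den r) z = 0 then None
     else Some (poly (ratfun_num r) z / poly (ratfun_den r) z))"
| "ratfun_map r None =
    (if coeff (ratfun_den r) (ratfun_degree r) = 0 then None
     else Some (coeff (ratfun_num r) (ratfun_degree r) / coeff (ratfun_den r) (ratfun_degree r)))"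

definition real_ratfuns :: "complex poly fract set" where
  "real_ratfuns =
    {Fract (map_poly of_real p) (map_poly of_real q) | (p :: real poly) (q :: real poly). q \<noteq> 0}"

definition circle_in_sphere :: "complex option set \<Rightarrow> bool" where
  "circle_in_sphere S \<longleftrightarrow>
    (\<exists>c r. r > 0 \<and> S = Some ` sphere c r) \<or>
    (\<exists>a b. b \<noteq> 0 \<and> S = insert None (Some ` {a + of_real t * b | t :: real. True}))"

definition jordan_curve_in_sphere :: "complex option set \<Rightarrow> bool" where
  "jordan_curve_in_sphere S \<longleftrightarrow>
    subtopology riemann_sphere S homeomorphic_space top_of_set (sphere (0 :: complex) 1)"

lemma ratfun_den_nonzero: "ratfun_den r \<noteq> 0"
  by (simp add: ratfun_den_def)

lemma coprime_ratfun_num_den: "coprime (ratfun_num r) (ratfun_den r)"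
  by (simp add: ratfun_num_def ratfun_den_def coprime_quot_of_fract)

lemma ratfun_eq_Fract: "r = Fract (ratfun_num r) (ratfun_den r)"
  by (metis ratfun_num_def ratfun_den_def quot_to_fract_quot_of_fract quot_to_fract_def
      prod.collapse case_prod_conv Fract_def Fract_conv_to_fract)

text \<open>A rational function is determined by its map. In particular a composition of maps of
  rational functions comes from at most one rational function.\<close>

lemma inj_ratfun_map: "inj ratfun_map"
proof (rule injI)
  fix r s assume eq: "ratfun_map r = ratfun_map s"
  define D where "D = ratfun_num r * ratfun_den s - ratfun_num s * ratfun_den r"
  have "D = 0"
  proof (rule ccontr)
    assume "D \<noteq> 0"
    then have "D * (ratfun_den r * ratfun_den s) \<noteq> 0"
      using ratfun_den_nonzero by simp
    then have "finite {z. poly (D * (ratfun_den r * ratfun_den s)) z = 0}"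
      by (rule poly_roots_finite)
    then obtain z where z: "poly (D * (ratfun_den r * ratfun_den s)) z \<noteq> 0"
      using infinite_UNIV_char_0[where 'a = complex] by (metis (mono_tags) ex_new_if_finite mem_Collect_eq)
    from fun_cong[OF eq, of "Some z"] z show False
      by (auto simp: D_def frac_eq_eq)
  qed
  then have "Fract (ratfun_num r) (ratfun_den r) = Fract (ratfun_num s) (ratfun_den s)"
    using ratfun_den_nonzero by (simp add: eq_fract D_def)
  then show "r = s"
    using ratfun_eq_Fract by metis
qed

end

theory Submission
  imports Defs "HOL-Complex_Analysis.Complex_Analysis"
begin

text \<open>
  Let \<open>E\<close> be a real elliptic curve and \<open>C\<close> a subgroup of order \<open>l\<close> of \<open>E\<close> that is not mapped to itself by complex
  conjugation. The isogeny \<open>E \<rightarrow> E / C\<close> and the dual isogeny \<open>E / C \<rightarrow> E / E[l] = E\<close> have degree \<open>l\<close>, and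
  their composition is the quotient by all of \<open>E[l]\<close>, which is defined over the reals. Dividing everything by an
  involution \<open>u \<mapsto> u\<^sub>0 - u\<close> turns the three curves into spheres, and the two isogenies into rational
  functions \<open>g\<close> and \<open>f\<close> of degree \<open>l\<close> such that \<open>f \<circ> g\<close> is real. If \<open>g\<close> mapped the real line into a circle, then
  \<open>g\<close> and its complex conjugate would differ by a Moebius transformation, so \<open>C\<close> would be stable under conjugation.

  Injectivity of \<open>g\<close> on the real line depends on the involution. It fails for \<open>u \<mapsto> -u\<close> and a conjugation that fixes
  the origin. Here no fixed point of the involution lies over the real circle. Multiplicatively, take
  \<open>E = \<complex>\<^sup>* / c\<^bsup>2\<int>\<^esup>\<close> with \<open>0 < c < 1\<close>, the involution \<open>z \<mapsto> 1 / (c z)\<close> and the real structure \<open>z \<mapsto> 1 / cnj z\<close>. The unit circle is then mapped bijectively to the real circle of the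
  quotient sphere. The subgroup generated by \<open>\<gamma> = exp (2 \<pi> \<i> / l) c\<^bsup>2/l\<^esup>\<close> plays the role of \<open>C\<close>, and
  \<open>E / C = \<complex>\<^sup>* / \<gamma>\<^bsup>\<int>\<^esup>\<close>. Two points of the unit circle never have the same image in the
  quotient of \<open>E / C\<close> by the involution: the absolute values of the powers of \<open>\<gamma>\<close>, and those of \<open>1 / c\<close> times
  the powers of \<open>\<gamma>\<close>, differ from 1, apart from \<open>\<gamma>\<^sup>0\<close>; for the second family this is where \<open>l\<close> odd
  enters.

  The quotient by the involution is given by an explicit function with two simple poles modulo periods, the sum
  \<open>dipole_sum q c z\<close> of \<open>1 / (1 - t) - 1 / (1 - c t)\<close> over \<open>t \<in> q\<^bsup>\<int>\<^esup> z\<close>. One fact about it,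
  \<open>dipole_sum_quotient_product_constant\<close>, carries the proof: \<open>1 / (dipole_sum q c z - dipole_sum q c a)\<close> is, up to an
  affine change, again a function of this kind, with poles at \<open>a\<close> and \<open>1 / (c a)\<close>. It follows from Liouville's
  theorem. It implies that \<open>dipole_sum q c\<close> separates the orbits (\<open>dipole_sum_eq_imp_orbit\<close>), and it turns the
  sum of translates of \<open>dipole_sum q c\<close> by a finite subgroup, that is, the corresponding function of the quotient
  curve, into an explicit partial fraction in \<open>dipole_sum q c\<close> (\<open>dipole_sum_partial_fractions\<close>). This produces both \<open>g\<close>
  and \<open>f\<close>, and their degree can be read off.
\<close>

section \<open>Rational functions as maps of the sphere\<close>

lemma coprime_poly_no_common_root:
  fixes p q :: "complex poly"
  assumes "\<And>z. poly p z = 0 \<Longrightarrow> poly q z \<noteq> 0"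
  shows "coprime p q"
proof (rule coprimeI)
  fix d assume "d dvd p" "d dvd q"
  have no_root: "poly d z \<noteq> 0" for z
  proof
    assume "poly d z = 0"
    then have "poly p z = 0" "poly q z = 0"
      using \<open>d dvd p\<close> \<open>d dvd q\<close> by (auto elim!: dvdE)
    then show False using assms by blast
  qed
  have "degree d = 0"
  proof (rule ccontr)
    assume "degree d \<noteq> 0"
    then have "\<not> constant (poly d)" by (simp add: constant_degree)
    then have "\<exists>z. poly d z = 0" by (rule Fundamental_Theorem_Algebra.fundamental_theorem_of_algebra)
    then show False using no_root by simp
  qed
  moreover have "d \<noteq> 0"
    using no_root by auto
  ultimately show "is_unit d"
    by (simp add: is_unit_iff_degree)
qed

lemma coprime_imp_no_common_root:
  fixes p q :: "complex poly"
  assumes "coprime p q" "poly p z = 0"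
  shows "poly q z \<noteq> 0"
proof
  assume "poly q z = 0"
  then have "is_unit [:-z, 1:]"
    using assms by (meson coprime_common_divisor poly_eq_0_iff_dvd)
  then show False
    by (simp add: is_unit_iff_degree)
qed

text \<open>The reduced representation of a fraction is unique up to a common constant, which cancels in all values.\<close>
lemma ratfun_Fract_coprime:
  fixes p q :: "complex poly"
  assumes "coprime p q" "q \<noteq> 0"
  obtains a where "a \<noteq> 0" "ratfun_num (Fract p q) = smult a p" "ratfun_den (Fract p q) = smult a q"
proof -
  let ?n = "ratfun_num (Fract p q)" and ?d = "ratfun_den (Fract p q)"
  have "Fract p q = Fract ?n ?d"
    by (rule ratfun_eq_Fract)
  then have eq: "p * ?d = ?n * q"
    using assms(2) ratfun_den_nonzero by (simp add: eq_fract)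
  have "q dvd p * ?d" "?d dvd ?n * q"
    by (metis dvd_triv_right eq, metis dvd_triv_right eq)
  then have "q dvd ?d" "?d dvd q"
    using assms(1) coprime_ratfun_num_den[of "Fract p q"]
    by (simp_all add: coprime_commute coprime_dvd_mult_right_iff)
  then obtain u where u: "?d = q * u" "is_unit u"
    using assms(2) by (metis dvdE dvd_times_left_cancel_iff mult.right_neutral)
  then obtain a where a: "u = [:a:]" "a \<noteq> 0"
    by (metis is_unit_poly_iff not_is_unit_0 pCons_0_0)
  have d: "?d = smult a q"
    using u a by (simp add: mult.commute)
  then have "?n * q = smult a p * q"
    using eq by simp
  then have "?n = smult a p"
    using assms(2) by (metis mult_right_cancel)
  with d a show ?thesis using that by blast
qed

lemma ratfun_map_Fract_Some:
  fixes p q :: "complex poly"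
  assumes "coprime p q" "q \<noteq> 0"
  shows "ratfun_map (Fract p q) (Some z) = (if poly q z = 0 then None else Some (poly p z / poly q z))"
  by (rule ratfun_Fract_coprime[OF assms]) simp

lemma ratfun_degree_Fract:
  fixes p q :: "complex poly"
  assumes "coprime p q" "q \<noteq> 0"
  shows "ratfun_degree (Fract p q) = max (degree p) (degree q)"
  by (rule ratfun_Fract_coprime[OF assms]) (simp add: ratfun_degree_def)

lemma ratfun_map_Fract_None:
  fixes p q :: "complex poly"
  assumes "coprime p q" "q \<noteq> 0" "degree q < degree p"
  shows "ratfun_map (Fract p q) None = None"
  by (rule ratfun_Fract_coprime[OF assms(1,2)])
     (use assms(3) in \<open>simp add: ratfun_degree_Fract[OF assms(1,2)] coeff_eq_0\<close>)

text \<open>This is the form of degree \<open>n\<close> that belongs to \<open>P\<close>, evaluated at the pair \<open>(p, q)\<close>; it equals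
  \<open>q ^ n * P (p / q)\<close>, but also makes sense at the zeros of \<open>q\<close>.\<close>
definition homogenize :: "nat \<Rightarrow> complex poly \<Rightarrow> complex poly \<Rightarrow> complex poly \<Rightarrow> complex poly" where
  "homogenize n P p q = (\<Sum>i\<le>n. smult (coeff P i) (p ^ i * q ^ (n - i)))"

lemma poly_homogenize_nonzero:
  assumes "degree P \<le> n" "poly q z \<noteq> 0"
  shows "poly (homogenize n P p q) z = poly q z ^ n * poly P (poly p z / poly q z)"
proof -
  have "poly P (poly p z / poly q z) = (\<Sum>i\<le>n. coeff P i * (poly p z / poly q z) ^ i)"
    by (subst (1) poly_as_sum_of_monoms'[OF assms(1), symmetric]) (simp add: poly_sum poly_monom)
  moreover have "poly q z ^ n * (\<Sum>i\<le>n. coeff P i * (poly p z / poly q z) ^ i)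
      = (\<Sum>i\<le>n. coeff P i * (poly p z ^ i * poly q z ^ (n - i)))"
    unfolding sum_distrib_left
    by (intro sum.cong refl) (use assms(2) in \<open>simp add: power_divide power_diff\<close>)
  ultimately show ?thesis
    by (simp add: homogenize_def poly_sum)
qed

lemma poly_homogenize_zero:
  assumes "poly q z = 0"
  shows "poly (homogenize n P p q) z = coeff P n * poly p z ^ n"
proof -
  have "poly (homogenize n P p q) z = (\<Sum>i\<le>n. if i = n then coeff P n * poly p z ^ n else 0)"
    unfolding homogenize_def poly_sum
    by (intro sum.cong refl) (use assms in \<open>auto simp: power_0_left\<close>)
  then show ?thesis by simp
qed

lemma degree_homogenize_less:
  assumes "degree q < degree p" "coeff P n = 0" "0 < n"
  shows "degree (homogenize n P p q) < n * degree p"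
proof -
  have "degree (smult (coeff P i) (p ^ i * q ^ (n - i))) < n * degree p" if "i \<le> n" for i
  proof (cases "i = n")
    case False
    have "degree (smult (coeff P i) (p ^ i * q ^ (n - i))) \<le> i * degree p + (n - i) * degree q"
      using degree_smult_le[of "coeff P i" "p ^ i * q ^ (n - i)"] degree_mult_le[of "p ^ i" "q ^ (n - i)"]
        degree_power_le[of p i] degree_power_le[of q "n - i"] by (simp add: mult.commute)
    also have "\<dots> < i * degree p + (n - i) * degree p"
      using False that assms(1) by simp
    also have "\<dots> = n * degree p"
      using that by (simp add: add_mult_distrib[symmetric])
    finally show ?thesis .
  qed (use assms in auto)
  then show ?thesis
    unfolding homogenize_def
    using assms by (intro degree_sum_less) auto
qed

lemma degree_homogenize_eq:
  assumes "degree q < degree p" "coeff P n \<noteq> 0" "0 < n"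
  shows "degree (homogenize n P p q) = n * degree p"
proof -
  have p0: "p \<noteq> 0" using assms(1) by auto
  define R where "R = P - monom (coeff P n) n"
  have "coeff R n = 0" by (simp add: R_def)
  have "homogenize n P p q = homogenize n R p q + homogenize n (monom (coeff P n) n) p q"
    by (simp add: homogenize_def R_def smult_diff_left sum_subtractf)
  also have "homogenize n (monom (coeff P n) n) p q = (\<Sum>i\<le>n. if i = n then smult (coeff P n) (p ^ n) else 0)"
    unfolding homogenize_def by (intro sum.cong refl) auto
  also have "\<dots> = smult (coeff P n) (p ^ n)"
    by simp
  finally have *: "homogenize n P p q = homogenize n R p q + smult (coeff P n) (p ^ n)" .
  have "degree (homogenize n R p q) < degree (smult (coeff P n) (p ^ n))"
    using degree_homogenize_less[OF assms(1) \<open>coeff R n = 0\<close> assms(3)] assms(1,2) p0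
    by (simp add: degree_power_eq)
  then have "degree (homogenize n P p q) = degree (smult (coeff P n) (p ^ n))"
    unfolding * by (rule degree_add_eq_right)
  also have "\<dots> = n * degree p"
    using assms p0 by (simp add: degree_power_eq)
  finally show ?thesis .
qed

text \<open>Both functions fix infinity, so the behaviour of the composition at infinity is a matter of degrees. The homogenized pair is coprime because a common zero would give a
  common zero of \<open>P\<close> and \<open>Q\<close>, or of \<open>p\<close> and \<open>q\<close>.\<close>
lemma ratfun_map_comp_Fract:
  fixes P Q p q :: "complex poly"
  assumes PQ: "coprime P Q" "Q \<noteq> 0" "degree Q < degree P"
    and pq: "coprime p q" "q \<noteq> 0" "degree q < degree p"
  defines "n \<equiv> degree P"
  shows "ratfun_map (Fract P Q) \<circ> ratfun_map (Fract p q)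
    = ratfun_map (Fract (homogenize n P p q) (homogenize n Q p q))"
    and "homogenize n Q p q \<noteq> 0" and "coprime (homogenize n P p q) (homogenize n Q p q)"
proof -
  let ?A = "homogenize n P p q" and ?B = "homogenize n Q p q"
  have n: "n > 0" "degree Q < n" "coeff P n \<noteq> 0" "coeff Q n = 0"
    using PQ unfolding n_def by (auto intro: coeff_eq_0)
  show cop: "coprime ?A ?B"
  proof (rule coprime_poly_no_common_root)
    fix z assume z: "poly ?A z = 0"
    show "poly ?B z \<noteq> 0"
    proof (cases "poly q z = 0")
      case True
      then have "poly p z \<noteq> 0"
        using pq(1) coprime_imp_no_common_root by blast
      with z True n show ?thesis by (simp add: poly_homogenize_zero)
    next
      case False
      then have "poly P (poly p z / poly q z) = 0"
        using z poly_homogenize_nonzero[of P n q z p] n_def by simp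
      then have "poly Q (poly p z / poly q z) \<noteq> 0"
        by (rule coprime_imp_no_common_root[OF PQ(1)])
      with False n show ?thesis
        using poly_homogenize_nonzero[of Q n q z p] by simp
    qed
  qed
  have degA: "degree ?A = n * degree p"
    by (rule degree_homogenize_eq) (use pq n in auto)
  have degB: "degree ?B < n * degree p"
    by (rule degree_homogenize_less) (use pq n in auto)
  show B0: "?B \<noteq> 0"
  proof
    assume "?B = 0"
    then have "is_unit ?A" using cop by simp
    then have "degree ?A = 0" by (auto simp: is_unit_poly_iff)
    with degA degB show False by linarith
  qed
  show "ratfun_map (Fract P Q) \<circ> ratfun_map (Fract p q) = ratfun_map (Fract ?A ?B)"
  proof
    fix x
    show "(ratfun_map (Fract P Q) \<circ> ratfun_map (Fract p q)) x = ratfun_map (Fract ?A ?B) x"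
    proof (cases x)
      case None
      then show ?thesis
        using ratfun_map_Fract_None[OF PQ] ratfun_map_Fract_None[OF pq]
          ratfun_map_Fract_None[OF cop B0] degA degB by simp
    next
      case (Some z)
      show ?thesis
      proof (cases "poly q z = 0")
        case True
        then show ?thesis
          using Some n ratfun_map_Fract_None[OF PQ]
          by (simp add: ratfun_map_Fract_Some[OF pq(1,2)] ratfun_map_Fract_Some[OF cop B0]
              poly_homogenize_zero del: ratfun_map.simps)
      next
        case False
        then show ?thesis
          using Some n poly_homogenize_nonzero[of Q n q z p] poly_homogenize_nonzero[of P n q z p]
          by (simp add: ratfun_map_Fract_Some[OF pq(1,2)] ratfun_map_Fract_Some[OF cop B0]
              ratfun_map_Fract_Some[OF PQ(1,2)] del: ratfun_map.simps flip: n_def)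
      qed
    qed
  qed
qed

abbreviation poly_cnj :: "complex poly \<Rightarrow> complex poly" where
  "poly_cnj \<equiv> map_poly cnj"

lemma coeff_poly_cnj: "coeff (poly_cnj p) n = cnj (coeff p n)"
  by (simp add: coeff_map_poly)

lemma degree_poly_cnj: "degree (poly_cnj p) = degree p"
  by (simp add: degree_map_poly)

lemma poly_poly_cnj: "poly (poly_cnj p) z = cnj (poly p (cnj z))"
  by (simp add: poly_altdef coeff_poly_cnj degree_poly_cnj)

lemma poly_eq_if_infinite:
  fixes p q :: "'a::idom poly"
  assumes "infinite S" "\<And>x. x \<in> S \<Longrightarrow> poly p x = poly q x"
  shows "p = q"
proof (rule ccontr)
  assume "p \<noteq> q"
  then have "finite {x. poly (p - q) x = 0}"
    by (intro poly_roots_finite) simp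
  moreover have "S \<subseteq> {x. poly (p - q) x = 0}"
    using assms(2) by auto
  ultimately show False
    using assms(1) finite_subset by blast
qed

lemma poly_cnj_invariant_imp_real:
  assumes "poly_cnj p = p"
  shows "map_poly of_real (map_poly Re p) = p"
proof (rule poly_eqI)
  fix n
  have "cnj (coeff p n) = coeff p n"
    using assms by (metis coeff_poly_cnj)
  then show "coeff (map_poly of_real (map_poly Re p)) n = coeff p n"
    by (simp add: coeff_map_poly complex_eq_iff)
qed

lemma poly_cnj_mult: "poly_cnj (p * q) = poly_cnj p * poly_cnj q"
  by (rule poly_eq_if_infinite[of UNIV]) (simp_all add: poly_poly_cnj infinite_UNIV_char_0)

lemma poly_cnj_poly_cnj: "poly_cnj (poly_cnj p) = p"
  by (rule poly_eqI) (simp add: coeff_poly_cnj)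

text \<open>Real values at infinitely many real points force \<open>p * poly_cnj q = poly_cnj p * q\<close>; so extending the fraction
  by \<open>poly_cnj q\<close> makes numerator and denominator real.\<close>
lemma Fract_real_if_real_values:
  fixes p q :: "complex poly"
  assumes "q \<noteq> 0" "infinite S" "S \<subseteq> \<real>"
    and "\<And>x. x \<in> S \<Longrightarrow> poly q x \<noteq> 0 \<and> poly p x / poly q x \<in> \<real>"
  shows "Fract p q \<in> real_ratfuns"
proof -
  let ?A = "p * poly_cnj q" and ?B = "q * poly_cnj q"
  have q': "poly_cnj q \<noteq> 0"
    using assms(1) by (metis poly_cnj_poly_cnj map_poly_0)
  have "?A = poly_cnj p * q"
  proof (rule poly_eq_if_infinite[OF assms(2)])
    fix x assume x: "x \<in> S"
    then have "cnj x = x" using assms(3) by (auto simp: Reals_cnj_iff)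
    moreover have "cnj (poly p x / poly q x) = poly p x / poly q x" "poly q x \<noteq> 0"
      using assms(4)[OF x] by (auto simp: Reals_cnj_iff)
    ultimately show "poly ?A x = poly (poly_cnj p * q) x"
      by (simp add: poly_poly_cnj field_simps)
  qed
  then have "poly_cnj ?A = ?A" "poly_cnj ?B = ?B"
    by (simp_all add: poly_cnj_mult poly_cnj_poly_cnj mult.commute)
  then have *: "map_poly of_real (map_poly Re ?A) = ?A" "map_poly of_real (map_poly Re ?B) = ?B"
    by (auto intro: poly_cnj_invariant_imp_real)
  have "map_poly Re ?B \<noteq> 0"
    using * assms(1) q' by (metis map_poly_0 mult_eq_0_iff)
  moreover have "Fract p q = Fract ?A ?B"
    using assms(1) q' by (simp add: eq_fract)
  ultimately show ?thesis
    unfolding real_ratfuns_def using * by (metis (mono_tags, lifting) mem_Collect_eq)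
qed

text \<open>A rational function that maps the real line into the line \<open>a + \<real> b\<close> satisfies
  \<open>(p / q - a) / b = cnj ((p / q - a) / b)\<close> on the reals, and hence as an identity of rational functions. The two sides
  have conjugate poles. This is how \<open>g(\<real>)\<close> is shown not to be a line.\<close>
lemma roots_closed_under_cnj_if_line:
  fixes p q :: "complex poly"
  assumes "coprime p q" "q \<noteq> 0" "b \<noteq> 0"
    and line: "\<And>x. x \<in> \<real> \<Longrightarrow> poly q x \<noteq> 0 \<Longrightarrow> \<exists>t::real. poly p x / poly q x = a + of_real t * b"
    and z: "poly q z = 0"
  shows "poly q (cnj z) = 0"
proof -
  define N where "N = p - smult a q"
  have "N * smult (cnj b) (poly_cnj q) = smult b (poly_cnj N) * q"
  proof (rule poly_eq_if_infinite)
    have "infinite (range complex_of_real)"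
      using infinite_UNIV_char_0 by (simp add: finite_image_iff inj_of_real)
    then show "infinite (\<real> - {x. poly q x = 0})"
      using poly_roots_finite[OF assms(2)] by (simp add: Reals_def)
    fix x assume x: "x \<in> \<real> - {x. poly q x = 0}"
    then obtain t where t: "poly p x / poly q x = a + complex_of_real t * b"
      using line by auto
    then have N: "poly N x = of_real t * b * poly q x"
      using x by (simp add: N_def field_simps)
    have "cnj x = x" using x by (auto simp: Reals_cnj_iff)
    then show "poly (N * smult (cnj b) (poly_cnj q)) x = poly (smult b (poly_cnj N) * q) x"
      by (simp add: poly_poly_cnj N)
  qed
  then have "poly N z * (cnj b * cnj (poly q (cnj z))) = 0"
    using z by (metis mult_zero_right poly_mult poly_poly_cnj poly_smult)
  moreover have "poly N z \<noteq> 0"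
    using coprime_imp_no_common_root[of q p z] assms(1) z by (simp add: N_def coprime_commute)
  ultimately show ?thesis using assms(3) by simp
qed

section \<open>Rational functions given by simple poles\<close>

definition pf_den :: "complex set \<Rightarrow> complex poly" where
  "pf_den T = (\<Prod>t\<in>T. [:-t, 1:])"

text \<open>The quotient \<open>pf_num \<kappa> r T / pf_den T\<close> is \<open>z + \<kappa> + (\<Sum>t\<in>T. r t / (z - t))\<close>.\<close>
definition pf_num :: "complex \<Rightarrow> (complex \<Rightarrow> complex) \<Rightarrow> complex set \<Rightarrow> complex poly" where
  "pf_num \<kappa> r T = [:\<kappa>, 1:] * pf_den T + (\<Sum>t\<in>T. smult (r t) (pf_den (T - {t})))"

lemma poly_pf_den: "finite T \<Longrightarrow> poly (pf_den T) z = 0 \<longleftrightarrow> z \<in> T"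
  by (auto simp: pf_den_def poly_prod)

lemma pf_den_nonzero: "finite T \<Longrightarrow> pf_den T \<noteq> 0"
  by (auto simp: pf_den_def)

lemma degree_pf_den: "degree (pf_den T) = card T"
proof -
  have "degree (pf_den T) = (\<Sum>t\<in>T. degree [:- t, 1:])"
    unfolding pf_den_def by (rule degree_prod_eq_sum_degree) auto
  then show ?thesis by simp
qed

lemma poly_pf_den_remove:
  assumes "finite T" "t \<in> T"
  shows "poly (pf_den T) z = (z - t) * poly (pf_den (T - {t})) z"
  using prod.remove[OF assms, of "\<lambda>s. z - s"] by (simp add: pf_den_def poly_prod)

lemma poly_pf_num:
  assumes "finite T" "z \<notin> T"
  shows "poly (pf_num \<kappa> r T) z / poly (pf_den T) z = z + \<kappa> + (\<Sum>t\<in>T. r t / (z - t))"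
proof -
  have nz: "poly (pf_den T) z \<noteq> 0" using assms by (simp add: poly_pf_den)
  have "(\<Sum>t\<in>T. r t * poly (pf_den (T - {t})) z) / poly (pf_den T) z = (\<Sum>t\<in>T. r t / (z - t))"
    unfolding sum_divide_distrib
  proof (intro sum.cong refl)
    fix t assume t: "t \<in> T"
    have "poly (pf_den (T - {t})) z \<noteq> 0" "z \<noteq> t"
      using assms t by (auto simp: poly_pf_den)
    then show "r t * poly (pf_den (T - {t})) z / poly (pf_den T) z = r t / (z - t)"
      using poly_pf_den_remove[OF assms(1) t, of z] by simp
  qed
  then show ?thesis
    using nz by (simp add: pf_num_def poly_sum add_divide_distrib algebra_simps)
qed

lemma poly_pf_num_pole:
  assumes "finite T" "t \<in> T"
  shows "poly (pf_num \<kappa> r T) t = r t * poly (pf_den (T - {t})) t"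
proof -
  have "(\<Sum>s\<in>T. r s * poly (pf_den (T - {s})) t)
      = (\<Sum>s\<in>T. if s = t then r t * poly (pf_den (T - {t})) t else 0)"
    by (intro sum.cong refl) (use assms in \<open>auto simp: poly_pf_den\<close>)
  then show ?thesis
    using assms poly_pf_den[of T t] by (simp add: pf_num_def poly_sum)
qed

lemma degree_pf_num:
  assumes "finite T"
  shows "degree (pf_num \<kappa> r T) = card T + 1"
proof -
  have 1: "degree ([:\<kappa>, 1:] * pf_den T) = card T + 1"
    using assms by (simp add: degree_mult_eq pf_den_nonzero degree_pf_den del: mult_pCons_left)
  have "degree (\<Sum>t\<in>T. smult (r t) (pf_den (T - {t}))) \<le> card T"
    by (rule degree_sum_le) (auto simp: assms degree_pf_den
        intro!: order.trans[OF degree_smult_le] card_mono)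
  with 1 show ?thesis
    unfolding pf_num_def by (subst degree_add_eq_left) auto
qed

lemma coprime_pf:
  assumes "finite T" "\<And>t. t \<in> T \<Longrightarrow> r t \<noteq> 0"
  shows "coprime (pf_num \<kappa> r T) (pf_den T)"
proof (rule coprime_poly_no_common_root)
  fix z assume "poly (pf_num \<kappa> r T) z = 0"
  then have "z \<notin> T"
    using poly_pf_num_pole[OF assms(1), of z \<kappa> r] assms(2)[of z] poly_pf_den[of "T - {z}" z] assms(1)
    by fastforce
  then show "poly (pf_den T) z \<noteq> 0"
    using assms(1) by (simp add: poly_pf_den)
qed

section \<open>Jordan curves through infinity\<close>

text \<open>The curve extends to the whole circle by sending 1 to infinity. This is a continuous injection of a compact
  space into a Hausdorff space, hence a homeomorphism onto its image.\<close>
lemma jordan_curve_through_infinity: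
  fixes \<psi> :: "complex \<Rightarrow> complex"
  defines "S \<equiv> sphere (0::complex) 1"
  assumes cont: "continuous_on (S - {1}) \<psi>" and inj: "inj_on \<psi> (S - {1})"
    and inf: "filterlim \<psi> at_infinity (at 1)"
  shows "jordan_curve_in_sphere (insert None (Some ` \<psi> ` (S - {1})))"
proof -
  define \<Psi> where "\<Psi> = (\<lambda>z. if z = 1 then None else Some (\<psi> z))"
  have S1: "openin (top_of_set S) (S - {1})"
    by (simp add: openin_delete)
  have pre: "openin (top_of_set S) {z \<in> S - {1}. \<psi> z \<in> U}" if "open U" for U
  proof -
    have "openin (top_of_set (S - {1})) ((S - {1}) \<inter> \<psi> -` U)"
      using cont that by (rule continuous_openin_preimage_gen)
    then have "openin (top_of_set S) ((S - {1}) \<inter> \<psi> -` U)"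
      using S1 openin_trans by blast
    also have "(S - {1}) \<inter> \<psi> -` U = {z \<in> S - {1}. \<psi> z \<in> U}" by auto
    finally show ?thesis .
  qed
  have "continuous_map (top_of_set S) riemann_sphere \<Psi>"
    unfolding continuous_map_def
  proof (intro conjI allI impI)
    show "\<Psi> \<in> topspace (top_of_set S) \<rightarrow> topspace riemann_sphere"
      by (auto simp: \<Psi>_def)
    fix V assume "openin riemann_sphere V"
    then consider U where "open U" "V = Some ` U" | C where "compact C" "V = insert None (Some ` (UNIV - C))"
      by (auto simp: openin_Alexandroff_compactification)
    then show "openin (top_of_set S) {z \<in> topspace (top_of_set S). \<Psi> z \<in> V}"
    proof cases
      case 1
      then have "{z \<in> topspace (top_of_set S). \<Psi> z \<in> V} = {z \<in> S - {1}. \<psi> z \<in> U}"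
        by (auto simp: \<Psi>_def)
      with pre[OF 1(1)] show ?thesis by simp
    next
      case 2
      obtain B where B: "\<And>w. w \<in> C \<Longrightarrow> norm w \<le> B"
        using compact_imp_bounded[OF 2(1)] by (auto simp: bounded_iff)
      have "\<forall>\<^sub>F z in at 1. B < norm (\<psi> z)"
        using filterlim_at_infinity_imp_norm_at_top[OF inf] by (simp add: filterlim_at_top_dense)
      then obtain e where e: "e > 0" "\<And>z. z \<noteq> 1 \<Longrightarrow> dist z 1 < e \<Longrightarrow> B < norm (\<psi> z)"
        unfolding eventually_at by auto
      have "{z \<in> topspace (top_of_set S). \<Psi> z \<in> V} = {z \<in> S - {1}. \<psi> z \<in> -C} \<union> (S \<inter> ball 1 e)"
      proof -
        have "\<psi> z \<notin> C" if "z \<noteq> 1" "z \<in> ball 1 e" for z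
          using e(2)[of z] B[of "\<psi> z"] that by (force simp: dist_commute)
        then show ?thesis
          using 2(2) e(1) by (auto simp: \<Psi>_def S_def split: if_splits)
      qed
      moreover have "openin (top_of_set S) (S \<inter> ball 1 e)" by (rule openin_open_Int) simp
      moreover have "open (-C)" using 2(1) by (simp add: compact_imp_closed open_Compl)
      ultimately show ?thesis using pre[of "-C"] by (simp add: openin_Un)
    qed
  qed
  then have "continuous_map (top_of_set S) (subtopology riemann_sphere (\<Psi> ` S)) \<Psi>"
    by (auto simp: continuous_map_in_subtopology)
  then have "homeomorphic_map (top_of_set S) (subtopology riemann_sphere (\<Psi> ` S)) \<Psi>"
  proof (rule continuous_imp_homeomorphic_map)
    show "compact_space (top_of_set S)"
      by (simp add: S_def compact_space_subtopology)
    have "Hausdorff_space riemann_sphere"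
      by (simp add: Hausdorff_space_Alexandroff_compactification locally_compact_space_euclidean Hausdorff_space_euclidean)
    then show "Hausdorff_space (subtopology riemann_sphere (\<Psi> ` S))"
      by (rule Hausdorff_space_subtopology)
    show "inj_on \<Psi> (topspace (top_of_set S))"
      using inj by (auto simp: \<Psi>_def inj_on_def)
  qed (auto simp: \<Psi>_def)
  moreover have "\<Psi> ` S = insert None (Some ` \<psi> ` (S - {1}))"
    by (auto simp: \<Psi>_def S_def image_iff)
  ultimately show ?thesis
    unfolding jordan_curve_in_sphere_def S_def
    by (metis homeomorphic_map_imp_homeomorphic_space homeomorphic_space_sym)
qed

section \<open>An elliptic function with two simple poles\<close>

definition dipole :: "complex \<Rightarrow> complex \<Rightarrow> complex" where
  "dipole c t = 1 / (1 - t) - 1 / (1 - c * t)"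

text \<open>As a function of \<open>z\<close> in \<open>\<complex>\<^sup>*\<close>, for \<open>0 < norm q < 1\<close>, this is an elliptic function in multiplicative form: the
  period lattice is \<open>q\<^bsup>\<int>\<^esup>\<close>, and the poles are simple and form the two classes of 1 and \<open>1 / c\<close>. The two
  terms of a dipole are kept together because only their difference is summable in both directions.\<close>
definition dipole_sum :: "complex \<Rightarrow> complex \<Rightarrow> complex \<Rightarrow> complex" where
  "dipole_sum q c z = (\<Sum>\<^sub>\<infinity>k::int. dipole c (q powi k * z))"

definition off_poles :: "complex \<Rightarrow> complex \<Rightarrow> complex \<Rightarrow> bool" where
  "off_poles q c z \<longleftrightarrow> z \<noteq> 0 \<and> (\<forall>k::int. q powi k * z \<noteq> 1 \<and> c * (q powi k * z) \<noteq> 1)"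

lemma off_polesD:
  assumes "off_poles q c z"
  shows "z \<noteq> 0" "q powi k * z \<noteq> 1" "c * (q powi k * z) \<noteq> 1"
  using assms by (auto simp: off_poles_def)

lemma dipole_eq:
  assumes "t \<noteq> 1" "c * t \<noteq> 1"
  shows "dipole c t = (1 - c) * t / ((1 - t) * (1 - c * t))"
  using assms by (simp add: dipole_def field_simps)

lemma dipole_bound:
  assumes "norm t \<le> 1 / 2" "norm (c * t) \<le> 1 / 2"
  shows "norm (dipole c t) \<le> 4 * norm (1 - c) * norm t"
proof -
  have "norm (1 - t) \<ge> 1 / 2" "norm (1 - c * t) \<ge> 1 / 2"
    using assms norm_triangle_ineq2[of 1 t] norm_triangle_ineq2[of 1 "c * t"] by simp_all
  then have "norm (1 - t) * norm (1 - c * t) \<ge> (1 / 2) * (1 / 2)"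
    by (intro mult_mono) auto
  moreover have "t \<noteq> 1" "c * t \<noteq> 1"
    using assms by auto
  ultimately have "norm (dipole c t) \<le> norm (1 - c) * norm t / (1 / 4)"
    unfolding dipole_eq[OF \<open>t \<noteq> 1\<close> \<open>c * t \<noteq> 1\<close>] norm_divide norm_mult
    by (intro divide_left_mono) auto
  then show ?thesis by simp
qed

text \<open>The involution exchanges the two poles 1 and \<open>1 / c\<close> of the dipole. It also exchanges 0 and infinity, so it
  reduces the estimates for large arguments to those for small ones.\<close>
lemma dipole_reflect:
  assumes "c \<noteq> 0" "t \<noteq> 0" "t \<noteq> 1" "c * t \<noteq> 1"
  shows "dipole c (1 / (c * t)) = dipole c t"
proof -
  have nz: "1 - t \<noteq> 0" "1 - c * t \<noteq> 0" "c * t - 1 \<noteq> 0" "t - 1 \<noteq> 0" using assms by auto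
  have "1 - 1 / (c * t) = (c * t - 1) / (c * t)" "1 - c * (1 / (c * t)) = (t - 1) / t"
    using assms by (simp_all add: diff_divide_distrib)
  then have "dipole c (1 / (c * t)) = c * t / (c * t - 1) - t / (t - 1)"
    by (simp add: dipole_def)
  also have "\<dots> = dipole c t"
    using nz by (simp add: dipole_def divide_simps) (simp add: algebra_simps)
  finally show ?thesis .
qed

lemma summable_on_geometric_int:
  fixes x :: real
  assumes "0 \<le> x" "x < 1"
  shows "(\<lambda>k::int. x ^ nat \<bar>k\<bar>) summable_on UNIV"
proof -
  have nat: "(\<lambda>n. x ^ n) summable_on UNIV"
    using assms by (intro norm_summable_imp_summable_on) (simp add: summable_geometric)
  have "(\<lambda>k::int. x ^ nat \<bar>k\<bar>) summable_on int ` UNIV"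
    by (subst summable_on_reindex) (use nat in \<open>auto simp: o_def\<close>)
  moreover have "(\<lambda>k::int. x ^ nat \<bar>k\<bar>) summable_on (\<lambda>n. - int n) ` UNIV"
    by (subst summable_on_reindex) (use nat in \<open>auto simp: o_def inj_on_def\<close>)
  ultimately have "(\<lambda>k::int. x ^ nat \<bar>k\<bar>) summable_on (int ` UNIV \<union> (\<lambda>n. - int n) ` UNIV)"
    by (rule summable_on_union)
  also have "int ` UNIV \<union> (\<lambda>n. - int n) ` UNIV = UNIV"
  proof -
    have "k \<in> int ` UNIV \<union> (\<lambda>n. - int n) ` UNIV" for k :: int
      by (cases k rule: int_cases2) auto
    then show ?thesis by blast
  qed
  finally show ?thesis .
qed

text \<open>The terms decay geometrically in both directions: for \<open>k \<ge> 0\<close> by \<open>dipole_bound\<close>, and for \<open>k < 0\<close> by the same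
  bound after \<open>dipole_reflect\<close>.\<close>
lemma dipole_tail_bound:
  fixes q c :: complex and r R :: real
  assumes q: "q \<noteq> 0" "norm q < 1" and c: "c \<noteq> 0" and r: "0 < r"
  obtains N M where "\<And>(k::int) z. \<lbrakk>nat \<bar>k\<bar> \<ge> N; r \<le> norm z; norm z \<le> R\<rbrakk> \<Longrightarrow>
    q powi k * z \<noteq> 1 \<and> c * (q powi k * z) \<noteq> 1 \<and> norm (dipole c (q powi k * z)) \<le> M * norm q ^ nat \<bar>k\<bar>"
proof -
  \<comment> \<open>a common bound for the absolute values of \<open>t\<close>, \<open>c t\<close> and of their images under the involution, up to \<open>norm q ^ n\<close>\<close>
  define D where "D = max (max R (norm c * R)) (max (1 / (norm c * r)) (1 / r))"
  have D: "R \<le> D" "norm c * R \<le> D" "1 / (norm c * r) \<le> D" "1 / r \<le> D"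
    by (auto simp: D_def)
  have "D > 0" using D(4) r by (smt (verit) divide_pos_pos)
  have "\<forall>\<^sub>F n in sequentially. norm q ^ n < 1 / (2 * D)"
    using \<open>D > 0\<close> q by (intro order_tendstoD(2)[OF LIMSEQ_power_zero]) auto
  then obtain N where N: "\<And>n. n \<ge> N \<Longrightarrow> norm q ^ n < 1 / (2 * D)"
    by (auto simp: eventually_sequentially)
  have small: "norm q ^ n * x \<le> 1 / 2" if "n \<ge> N" "x \<le> D" for n x
  proof -
    have "norm q ^ n * x \<le> norm q ^ n * D"
      using that by (intro mult_left_mono) auto
    also have "\<dots> \<le> 1 / (2 * D) * D"
      using N[OF that(1)] \<open>D > 0\<close> by (intro mult_right_mono) auto
    finally show ?thesis using \<open>D > 0\<close> by simp
  qed
  show ?thesis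
  proof (rule that[of N "4 * norm (1 - c) * D"])
    fix k :: int and z :: complex
    assume k: "nat \<bar>k\<bar> \<ge> N" and z: "r \<le> norm z" "norm z \<le> R"
    define n where "n = nat \<bar>k\<bar>"
    define t where "t = q powi k * z"
    have "n \<ge> N" using k n_def by simp
    have t0: "t \<noteq> 0" using q z r by (auto simp: t_def)
    have main: "t \<noteq> 1 \<and> c * t \<noteq> 1 \<and> norm (dipole c t) \<le> 4 * norm (1 - c) * (norm q ^ n * D)"
    proof (cases "k \<ge> 0")
      case True
      then have "norm t = norm q ^ n * norm z"
        by (simp add: t_def n_def norm_mult norm_power power_int_def)
      then have le: "norm t \<le> norm q ^ n * R"
        using z by (simp add: mult_left_mono)
      then have "norm (c * t) \<le> norm q ^ n * (norm c * R)"
        using mult_left_mono[OF le, of "norm c"] by (simp add: norm_mult algebra_simps)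
      with le have s: "norm t \<le> 1 / 2" "norm (c * t) \<le> 1 / 2"
        using small[OF \<open>n \<ge> N\<close> D(1)] small[OF \<open>n \<ge> N\<close> D(2)] by simp_all
      have "norm t \<le> norm q ^ n * D"
        using le D(1) by (meson mult_left_mono norm_ge_zero order_trans zero_le_power)
      then have "4 * norm (1 - c) * norm t \<le> 4 * norm (1 - c) * (norm q ^ n * D)"
        by (intro mult_left_mono) auto
      with dipole_bound[OF s] s show ?thesis by auto
    next
      case False
      define s where "s = 1 / (c * t)"
      have it: "1 / t = q ^ n / z"
        using False q by (simp add: t_def n_def power_int_def field_simps)
      have le: "norm s \<le> norm q ^ n * (1 / (norm c * r))"
      proof -
        have "s = q ^ n * (1 / (c * z))"
          using it by (simp add: s_def) (metis divide_divide_eq_left' it)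
        then have "norm s = norm q ^ n * (1 / (norm c * norm z))"
          by (simp add: norm_divide norm_mult norm_power)
        also have "\<dots> \<le> norm q ^ n * (1 / (norm c * r))"
          using z r c by (intro mult_left_mono divide_left_mono mult_pos_pos) auto
        finally show ?thesis .
      qed
      have le': "norm (c * s) \<le> norm q ^ n * (1 / r)"
        using mult_left_mono[OF le, of "norm c"] c by (simp add: norm_mult)
      have s: "norm s \<le> 1 / 2" "norm (c * s) \<le> 1 / 2"
        using le le' small[OF \<open>n \<ge> N\<close> D(3)] small[OF \<open>n \<ge> N\<close> D(4)] by linarith+
      have "c * s = 1 / t" using c t0 by (simp add: s_def)
      with s(2) have t1: "t \<noteq> 1" by auto
      have t2: "c * t \<noteq> 1" using s(1) by (auto simp: s_def)
      have "norm s \<le> norm q ^ n * D"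
        using le D(3) by (meson mult_left_mono norm_ge_zero order_trans zero_le_power)
      then have "4 * norm (1 - c) * norm s \<le> 4 * norm (1 - c) * (norm q ^ n * D)"
        by (intro mult_left_mono) auto
      with dipole_bound[OF s] dipole_reflect[OF c t0 t1 t2] t1 t2 show ?thesis
        unfolding s_def by auto
    qed
    then show "q powi k * z \<noteq> 1 \<and> c * (q powi k * z) \<noteq> 1 \<and>
        norm (dipole c (q powi k * z)) \<le> 4 * norm (1 - c) * D * norm q ^ nat \<bar>k\<bar>"
      by (simp add: t_def n_def mult_ac)
  qed
qed

lemma finite_int_abs_less: "finite {k::int. nat \<bar>k\<bar> < N}"
  by (rule finite_subset[of _ "{- int N .. int N}"]) auto

lemma dipole_summable:
  assumes q: "q \<noteq> 0" "norm q < 1" and c: "c \<noteq> 0" and z: "z \<noteq> 0"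
  shows "(\<lambda>k::int. dipole c (q powi k * z)) summable_on A"
proof -
  obtain N M where NM: "\<And>k w. \<lbrakk>nat \<bar>k\<bar> \<ge> N; norm z \<le> norm w; norm w \<le> norm z\<rbrakk> \<Longrightarrow>
    q powi k * w \<noteq> 1 \<and> c * (q powi k * w) \<noteq> 1 \<and> norm (dipole c (q powi k * w)) \<le> M * norm q ^ nat \<bar>k\<bar>"
    by (rule dipole_tail_bound[OF q c, of "norm z" "norm z"]) (use z in auto)
  let ?K = "{k::int. nat \<bar>k\<bar> < N}"
  have "(\<lambda>k::int. dipole c (q powi k * z)) summable_on - ?K"
  proof (rule Infinite_Sum.abs_summable_summable, rule Infinite_Sum.abs_summable_on_comparison_test')
    show "(\<lambda>k::int. M * norm q ^ nat \<bar>k\<bar>) summable_on - ?K"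
      using summable_on_subset_banach[OF summable_on_geometric_int[of "norm q"]] q
      by (intro summable_on_cmult_right) auto
  qed (use NM[of _ z] in auto)
  moreover have "(\<lambda>k::int. dipole c (q powi k * z)) summable_on ?K"
    by (simp add: finite_int_abs_less)
  ultimately have "(\<lambda>k::int. dipole c (q powi k * z)) summable_on (?K \<union> - ?K)"
    by (intro summable_on_union)
  then show ?thesis
    by (rule summable_on_subset_banach) auto
qed

text \<open>On an annulus only finitely many terms have poles, and the sum of the others converges uniformly. All local
  properties of \<open>dipole_sum\<close> are read off from this decomposition.\<close>
lemma dipole_sum_finite_part:
  assumes q: "q \<noteq> 0" "norm q < 1" and c: "c \<noteq> 0" and r: "0 < r"
  obtains K where "finite K" "0 \<in> K"
    "\<And>k z. \<lbrakk>k \<notin> K; r < norm z; norm z < R\<rbrakk> \<Longrightarrow> q powi k * z \<noteq> 1 \<and> c * (q powi k * z) \<noteq> 1"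
    "(\<lambda>z. dipole_sum q c z - (\<Sum>k\<in>K. dipole c (q powi k * z))) analytic_on {z. r < norm z \<and> norm z < R}"
proof -
  obtain N0 M where NM0: "\<And>k z. \<lbrakk>nat \<bar>k\<bar> \<ge> N0; r \<le> norm z; norm z \<le> R\<rbrakk> \<Longrightarrow>
    q powi k * z \<noteq> 1 \<and> c * (q powi k * z) \<noteq> 1 \<and> norm (dipole c (q powi k * z)) \<le> M * norm q ^ nat \<bar>k\<bar>"
    using dipole_tail_bound[OF q c r] by blast
  \<comment> \<open>the successor makes sure that 0 is among the finitely many exceptional indices\<close>
  define N where "N = Suc N0"
  have NM: "q powi k * z \<noteq> 1 \<and> c * (q powi k * z) \<noteq> 1 \<and> norm (dipole c (q powi k * z)) \<le> M * norm q ^ nat \<bar>k\<bar>"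
    if "nat \<bar>k\<bar> \<ge> N" "r < norm z" "norm z < R" for k z
    using NM0[of k z] that by (simp add: N_def)
  let ?K = "{k::int. nat \<bar>k\<bar> < N}" and ?A = "{z::complex. r < norm z \<and> norm z < R}"
  define E where "E = (\<lambda>z. \<Sum>\<^sub>\<infinity>k\<in>-?K. dipole c (q powi k * z))"
  have opn: "open ?A"
    by (intro open_Collect_conj open_Collect_less continuous_intros)
  have unif: "uniform_limit ?A (\<lambda>X z. \<Sum>k\<in>X. dipole c (q powi k * z)) E (finite_subsets_at_top (-?K))"
    unfolding E_def
  proof (rule Weierstrass_m_test_general[where M = "\<lambda>k. M * norm q ^ nat \<bar>k\<bar>"])
    show "(\<lambda>k::int. M * norm q ^ nat \<bar>k\<bar>) summable_on - ?K"
      using summable_on_subset_banach[OF summable_on_geometric_int[of "norm q"]] q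
      by (intro summable_on_cmult_right) auto
  qed (use NM in auto)
  have "E analytic_on ?A"
    unfolding analytic_on_def
  proof
    fix z assume "z \<in> ?A"
    then obtain d where d: "d > 0" "cball z d \<subseteq> ?A"
      using opn open_contains_cball by blast
    show "\<exists>e>0. E holomorphic_on ball z e"
    proof (rule holomorphic_uniform_limit)
      show "\<forall>\<^sub>F X in finite_subsets_at_top (-?K).
          continuous_on (cball z d) (\<lambda>z. \<Sum>k\<in>X. dipole c (q powi k * z)) \<and>
          (\<lambda>z. \<Sum>k\<in>X. dipole c (q powi k * z)) holomorphic_on ball z d"
      proof (rule eventually_finite_subsets_at_top_weakI)
        fix X assume X: "X \<subseteq> -?K"
        have "(\<lambda>z. \<Sum>k\<in>X. dipole c (q powi k * z)) holomorphic_on cball z d"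
          unfolding dipole_def
          by (intro holomorphic_intros) (use NM X d in \<open>force simp: subset_eq\<close>)+
        then show "continuous_on (cball z d) (\<lambda>z. \<Sum>k\<in>X. dipole c (q powi k * z)) \<and>
          (\<lambda>z. \<Sum>k\<in>X. dipole c (q powi k * z)) holomorphic_on ball z d"
          using holomorphic_on_subset ball_subset_cball holomorphic_on_imp_continuous_on by blast
      qed
      show "uniform_limit (cball z d) (\<lambda>X z. \<Sum>k\<in>X. dipole c (q powi k * z)) E (finite_subsets_at_top (-?K))"
        using unif d(2) by (rule uniform_limit_on_subset)
    qed (use d in auto)
  qed
  moreover have "dipole_sum q c z - (\<Sum>k\<in>?K. dipole c (q powi k * z)) = E z" if "z \<in> ?A" for z
  proof -
    have z0: "z \<noteq> 0" using that r by auto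
    have "dipole_sum q c z = (\<Sum>\<^sub>\<infinity>k\<in>?K \<union> -?K. dipole c (q powi k * z))"
      by (simp add: dipole_sum_def)
    also have "\<dots> = (\<Sum>\<^sub>\<infinity>k\<in>?K. dipole c (q powi k * z)) + E z"
      unfolding E_def by (rule infsum_Un_disjoint) (use dipole_summable[OF q c z0] in auto)
    finally show ?thesis
      by (simp add: finite_int_abs_less)
  qed
  ultimately have "(\<lambda>z. dipole_sum q c z - (\<Sum>k\<in>?K. dipole c (q powi k * z))) analytic_on ?A"
    using opn by (metis (no_types, lifting) analytic_on_open holomorphic_transform)
  then show ?thesis
    using NM by (intro that[of ?K]) (auto simp: finite_int_abs_less N_def)
qed
lemma eventually_at_times_neq:
  fixes a b w :: complex
  assumes "b \<noteq> 0"
  shows "\<forall>\<^sub>F z in at w. a * z \<noteq> b"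
proof (cases "a = 0")
  case False
  have "\<forall>\<^sub>F z in at w. z \<noteq> b / a"
    by (rule eventually_neq_at_within)
  then show ?thesis
    by eventually_elim (use False in \<open>auto simp: field_simps\<close>)
qed (use assms in auto)

lemma eventually_off_poles:
  assumes q: "q \<noteq> 0" "norm q < 1" and c: "c \<noteq> 0" and w: "w \<noteq> 0"
  shows "\<forall>\<^sub>F z in at w. off_poles q c z"
proof -
  have r: "0 < norm w / 2" using w by simp
  obtain K where K: "finite K"
    "\<And>k z. \<lbrakk>k \<notin> K; norm w / 2 < norm z; norm z < 2 * norm w\<rbrakk> \<Longrightarrow> q powi k * z \<noteq> 1 \<and> c * (q powi k * z) \<noteq> 1"
    by (rule dipole_sum_finite_part[OF q c r, of "2 * norm w"]) blast
  have "\<forall>\<^sub>F z in at w. \<forall>k\<in>K. q powi k * z \<noteq> 1 \<and> (c * q powi k) * z \<noteq> 1"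
    using K(1) by (intro eventually_ball_finite ballI eventually_conj eventually_at_times_neq) auto
  moreover have "\<forall>\<^sub>F z in at w. norm w / 2 < norm z" "\<forall>\<^sub>F z in at w. norm z < 2 * norm w"
    using w by (auto intro!: order_tendstoD tendsto_intros)
  ultimately show ?thesis
  proof eventually_elim
    case (elim z)
    then have "q powi k * z \<noteq> 1 \<and> c * (q powi k * z) \<noteq> 1" for k
      using K(2)[of k z] by (cases "k \<in> K") (auto simp: mult.assoc)
    with elim w show ?case by (auto simp: off_poles_def)
  qed
qed

lemma open_off_poles:
  assumes q: "q \<noteq> 0" "norm q < 1" and c: "c \<noteq> 0"
  shows "open {z. off_poles q c z}"
  unfolding open_subopen[of "{z. off_poles q c z}"] eventually_nhds[symmetric]
proof safe
  fix z assume "off_poles q c z"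
  then have "\<forall>\<^sub>F w in nhds z. off_poles q c w"
    using eventually_off_poles[OF q c, of z] off_polesD(1)[of q c z]
    by (auto simp: eventually_nhds_conv_at)
  then show "\<exists>T. open T \<and> z \<in> T \<and> T \<subseteq> {z. off_poles q c z}"
    by (auto simp: eventually_nhds)
qed

lemma analytic_dipole:
  assumes "a * z \<noteq> 1" "c * (a * z) \<noteq> 1"
  shows "(\<lambda>z. dipole c (a * z)) analytic_on {z}"
  unfolding dipole_def by (intro analytic_intros) (use assms in auto)

lemma dipole_sum_analytic:
  assumes q: "q \<noteq> 0" "norm q < 1" and c: "c \<noteq> 0" and w: "off_poles q c w"
  shows "dipole_sum q c analytic_on {w}"
proof -
  have r: "0 < norm w / 2" using off_polesD(1)[OF w] by simp
  obtain K where K: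
    "(\<lambda>z. dipole_sum q c z - (\<Sum>k\<in>K. dipole c (q powi k * z))) analytic_on {z. norm w / 2 < norm z \<and> norm z < 2 * norm w}"
    by (rule dipole_sum_finite_part[OF q c r, of "2 * norm w"]) blast
  then have "(\<lambda>z. dipole_sum q c z - (\<Sum>k\<in>K. dipole c (q powi k * z))) analytic_on {w}"
    by (rule analytic_on_subset) (use r in auto)
  moreover have "(\<lambda>z. \<Sum>k\<in>K. dipole c (q powi k * z)) analytic_on {w}"
    using off_polesD[OF w] by (intro analytic_on_sum analytic_dipole) auto
  ultimately have "(\<lambda>z. dipole_sum q c z - (\<Sum>k\<in>K. dipole c (q powi k * z)) + (\<Sum>k\<in>K. dipole c (q powi k * z))) analytic_on {w}"
    by (rule analytic_on_add)
  then show ?thesis by simp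
qed

lemma powi_neq_1:
  fixes q :: "'a::real_normed_div_algebra"
  assumes "q \<noteq> 0" "norm q < 1" "k \<noteq> 0"
  shows "q powi k \<noteq> 1"
proof
  assume "q powi k = 1"
  then have "norm q powi k = 1"
    by (metis norm_one norm_power_int)
  then have "norm q ^ nat \<bar>k\<bar> = 1"
    by (cases "k > 0") (use assms in \<open>simp_all add: power_int_def power_inverse split: if_splits\<close>)
  moreover have "norm q ^ nat \<bar>k\<bar> < 1"
    using assms by (intro power_less_one_iff[THEN iffD2]) auto
  ultimately show False by simp
qed

text \<open>The pole at 1 comes from the first half of the term with \<open>k = 0\<close>. The difference is analytic at 1 itself, and not only near
  1, because division by zero yields 0 in both expressions.\<close>
lemma dipole_sum_pole_at_1:
  assumes q: "q \<noteq> 0" "norm q < 1" and c: "c \<noteq> 0" "\<And>k. c * q powi k \<noteq> 1"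
  shows "(\<lambda>z. dipole_sum q c z - 1 / (1 - z)) analytic_on {1}"
proof -
  have r: "0 < (1/2::real)" by simp
  obtain K where K: "finite K" "0 \<in> K"
    "(\<lambda>z. dipole_sum q c z - (\<Sum>k\<in>K. dipole c (q powi k * z))) analytic_on {z. 1/2 < norm z \<and> norm z < 2}"
    by (rule dipole_sum_finite_part[OF q c(1) r, of 2]) blast
  have "(\<lambda>z. dipole_sum q c z - (\<Sum>k\<in>K. dipole c (q powi k * z))) analytic_on {1}"
    using K(3) by (rule analytic_on_subset) auto
  moreover have "(\<lambda>z. \<Sum>k\<in>K-{0}. dipole c (q powi k * z)) analytic_on {1}"
    using powi_neq_1[OF q] c by (intro analytic_intros analytic_dipole) auto
  moreover have "(\<lambda>z. - 1 / (1 - c * z)) analytic_on {1}"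
    using c(2)[of 0] by (intro analytic_intros) auto
  ultimately have "(\<lambda>z. (dipole_sum q c z - (\<Sum>k\<in>K. dipole c (q powi k * z))) +
      ((\<Sum>k\<in>K-{0}. dipole c (q powi k * z)) + - 1 / (1 - c * z))) analytic_on {1}"
    by (intro analytic_on_add)
  moreover have "(\<Sum>k\<in>K. dipole c (q powi k * z)) = dipole c z + (\<Sum>k\<in>K-{0}. dipole c (q powi k * z))" for z
    using K(1,2) by (subst sum.remove[of K 0]) auto
  ultimately show ?thesis
    by (simp add: dipole_def)
qed

lemma dipole_sum_pole_at_1_residue:
  assumes q: "q \<noteq> 0" "norm q < 1" and c: "c \<noteq> 0" "\<And>k. c * q powi k \<noteq> 1"
  shows "((\<lambda>z. (z - 1) * dipole_sum q c z) \<longlongrightarrow> - 1) (at 1)"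
proof -
  define E where "E = (\<lambda>z. dipole_sum q c z - 1 / (1 - z))"
  have "isCont E 1"
    unfolding E_def using dipole_sum_pole_at_1[OF assms] analytic_at_imp_isCont by blast
  then have "((\<lambda>z. (z - 1) * E z - 1) \<longlongrightarrow> (1 - 1) * E 1 - 1) (at 1)"
    unfolding isCont_def by (intro tendsto_intros)
  moreover have "\<forall>\<^sub>F z in at 1. (z - 1) * E z - 1 = (z - 1) * dipole_sum q c z"
    using eventually_neq_at_within[of 1 1]
    by eventually_elim (simp add: E_def field_simps)
  ultimately show ?thesis
    by (simp add: tendsto_cong)
qed

lemma dipole_sum_times_q:
  assumes "q \<noteq> 0"
  shows "dipole_sum q c (q * z) = dipole_sum q c z"
  unfolding dipole_sum_def
  by (rule infsum_reindex_bij_witness[of _ "\<lambda>k. k - 1" "\<lambda>k. k + 1"])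
     (use assms in \<open>auto simp: power_int_add mult.assoc\<close>)

lemma powi_invariant:
  fixes q :: "'a::field"
  assumes q: "q \<noteq> 0" and f: "\<And>z. f (q * z) = f z"
  shows "f (q powi k * z) = f z"
proof -
  have *: "f (q ^ n * z) = f z" for n z
    by (induction n) (use f in \<open>auto simp: mult.assoc\<close>)
  show ?thesis
  proof (cases "k \<ge> 0")
    case True
    then show ?thesis using * by (simp add: power_int_def)
  next
    case False
    then have "q ^ nat (-k) * (q powi k * z) = z"
      using q by (simp add: power_int_def power_inverse)
    then show ?thesis using * by metis
  qed
qed

lemma powi_reflect:
  fixes q :: "'a::field"
  assumes "q \<noteq> 0"
  shows "q powi k * (1 / (c * z)) = 1 / (c * (q powi (-k) * z))"
  using assms by (simp add: power_int_minus divide_inverse mult_ac)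

lemma off_poles_reflect:
  assumes "q \<noteq> 0" "c \<noteq> 0"
  shows "off_poles q c (1 / (c * z)) \<longleftrightarrow> off_poles q c z"
proof -
  have *: "off_poles q c (1 / (c * z))" if z: "off_poles q c z" for z
    unfolding off_poles_def powi_reflect[OF assms(1)]
  proof (intro conjI allI)
    show "1 / (c * z) \<noteq> 0"
      using assms off_polesD(1)[OF z] by simp
    fix k :: int
    have "c * (1 / (c * (q powi - k * z))) = 1 / (q powi - k * z)"
      using assms by simp
    then show "1 / (c * (q powi - k * z)) \<noteq> 1" "c * (1 / (c * (q powi - k * z))) \<noteq> 1"
      using off_polesD(2,3)[OF z, of "-k"] by (metis divide_eq_1_iff)+
  qed
  have "off_poles q c z" if "off_poles q c (1 / (c * z))"
  proof -
    have "1 / (c * (1 / (c * z))) = z" using assms by simp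
    with *[OF that] show ?thesis by simp
  qed
  with * show ?thesis by blast
qed

lemma dipole_sum_reflect:
  assumes "q \<noteq> 0" "c \<noteq> 0" "off_poles q c z"
  shows "dipole_sum q c (1 / (c * z)) = dipole_sum q c z"
  unfolding dipole_sum_def
proof (rule infsum_reindex_bij_witness[of _ uminus uminus])
  fix k :: int
  show "dipole c (q powi (- k) * z) = dipole c (q powi k * (1 / (c * z)))"
    unfolding powi_reflect[OF assms(1)]
    by (rule dipole_reflect[symmetric]) (use off_polesD[OF assms(3)] assms in auto)
qed auto

section \<open>Liouville's theorem for multiplicatively periodic functions\<close>

lemma exists_powi_annulus:
  fixes q z :: complex
  assumes q: "q \<noteq> 0" "norm q < 1" and z: "z \<noteq> 0"
  obtains k :: int where "norm q \<le> norm (q powi k * z)" "norm (q powi k * z) \<le> 1"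
proof -
  define x where "x = - log (norm q) (norm z)"
  define k where "k = \<lceil>x\<rceil>"
  have q0: "0 < norm q" "norm q < 1" using q by auto
  have "norm z = norm q powr (- x)"
    using q0 z by (simp add: x_def)
  then have *: "norm (q powi k * z) = norm q powr (k - x)"
    using q0 by (simp add: norm_mult norm_power_int powr_diff powr_minus powr_real_of_int' field_simps)
  have "0 \<le> k - x" "k - x \<le> 1" by (simp_all add: k_def) linarith
  then have "norm q powr 1 \<le> norm q powr (k - x)" "norm q powr (k - x) \<le> norm q powr 0"
    using q0 by (intro powr_mono'; simp)+
  with * q0 show ?thesis by (intro that[of k]) auto
qed

text \<open>An elliptic function without poles is constant. Poles are excluded in the weak form that \<open>F\<close> is bounded near every
  point; the values at isolated singular points are arbitrary. By periodicity and compactness of a closed annulus,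
  \<open>F\<close> is bounded, so the removable singularities of \<open>F \<circ> exp\<close> can be filled to give a bounded entire function.\<close>
lemma elliptic_Liouville:
  fixes F :: "complex \<Rightarrow> complex"
  assumes q: "q \<noteq> 0" "norm q < 1"
    and per: "\<And>z. F (q * z) = F z"
    and iso: "\<And>w. w \<noteq> 0 \<Longrightarrow> \<forall>\<^sub>F z in at w. F analytic_on {z}"
    and bdd: "\<And>w. w \<noteq> 0 \<Longrightarrow> \<exists>B. \<forall>\<^sub>F z in at w. norm (F z) \<le> B"
  obtains \<mu> where "\<And>z. z \<noteq> 0 \<Longrightarrow> F analytic_on {z} \<Longrightarrow> F z = \<mu>"
proof -
  let ?A = "{z::complex. norm q \<le> norm z \<and> norm z \<le> 1}"
  have "compact ?A"
  proof -
    have "?A = cball 0 1 \<inter> {z. norm q \<le> norm z}" by auto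
    moreover have "closed {z::complex. norm q \<le> norm z}"
      by (intro closed_Collect_le continuous_intros)
    ultimately show ?thesis by (simp add: compact_Int_closed)
  qed
  have "\<exists>U B. open U \<and> w \<in> U \<and> (\<forall>z\<in>U. norm (F z) \<le> B)" if w: "w \<in> ?A" for w
  proof -
    have "w \<noteq> 0" using w q by auto
    then obtain B where "\<forall>\<^sub>F z in at w. norm (F z) \<le> B" using bdd by blast
    then have "\<forall>\<^sub>F z in nhds w. norm (F z) \<le> max B (norm (F w))"
      unfolding eventually_at_filter by eventually_elim auto
    then show ?thesis
      unfolding eventually_nhds by blast
  qed
  then obtain U B where UB: "\<And>w. w \<in> ?A \<Longrightarrow> open (U w) \<and> w \<in> U w \<and> (\<forall>z\<in>U w. norm (F z) \<le> B w)"
    by metis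
  obtain C where C: "C \<subseteq> ?A" "finite C" "?A \<subseteq> (\<Union>w\<in>C. U w)"
    using compactE_image[OF \<open>compact ?A\<close>, of ?A U] UB by blast
  define M where "M = Max (insert 0 (B ` C))"
  have bound_A: "norm (F z) \<le> M" if z: "z \<in> ?A" for z
  proof -
    obtain w where w: "w \<in> C" "z \<in> U w" using C(3) z by blast
    then have "norm (F z) \<le> B w" using UB C(1) by blast
    also have "\<dots> \<le> M" unfolding M_def using C(2) w by (intro Max_ge) auto
    finally show ?thesis .
  qed
  have bound: "norm (F z) \<le> M" if z: "z \<noteq> 0" for z
  proof -
    obtain k where "norm q \<le> norm (q powi k * z)" "norm (q powi k * z) \<le> 1"
      by (rule exists_powi_annulus[OF q z])
    then have "norm (F (q powi k * z)) \<le> M" by (intro bound_A) auto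
    then show ?thesis using powi_invariant[where f = F and q = q and z = z and k = k] q per by simp
  qed
  define G where "G = F \<circ> exp"
  have ana: "G analytic_on {u}" if "F analytic_on {exp u}" for u
    unfolding G_def by (rule analytic_on_compose) (use that in \<open>auto intro!: analytic_intros\<close>)
  have isoG: "isolated_singularity_at G u" for u
  proof -
    have "filterlim exp (at (exp u)) (at u)"
    proof (rule filterlim_atI)
      have "\<forall>\<^sub>F v in at u. v \<in> ball u (pi)" 
        by (intro eventually_at_in_open') auto
      then show "\<forall>\<^sub>F v in at u. exp v \<noteq> exp u"
        using eventually_neq_at_within[of u u]
      proof eventually_elim
        case (elim v)
        then have "norm (v - u) < pi"
          by (simp add: dist_norm norm_minus_commute)
        then have "\<bar>Im v - Im u\<bar> < 2 * pi"
          using abs_Im_le_cmod[of "v - u"] pi_gt_zero by (simp add: less_le_trans)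
        then show ?case using exp_complex_eqI[of v u] elim by auto
      qed
    qed (auto intro!: tendsto_intros)
    then have "\<forall>\<^sub>F v in at u. F analytic_on {exp v}"
      using iso[of "exp u"] by (auto simp: filterlim_iff)
    then have "\<forall>\<^sub>F v in at u. G analytic_on {v}"
      by eventually_elim (rule ana)
    then show ?thesis
      by (auto simp: isolated_singularity_at_altdef)
  qed
  have limG: "\<exists>L. G \<midarrow>u\<rightarrow> L" for u
  proof -
    obtain r where r: "r > 0" "G analytic_on ball u r - {u}"
      using isoG unfolding isolated_singularity_at_def by blast
    then have "G holomorphic_on ball u r - {u}" by (simp add: analytic_imp_holomorphic)
    moreover have "\<exists>B. \<forall>\<^sub>F z in at u. norm (G z) \<le> B"
      using bound by (auto simp: G_def intro!: exI[of _ M])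
    ultimately obtain g where g: "g holomorphic_on ball u r" "\<forall>z\<in>ball u r - {u}. g z = G z"
      using holomorphic_on_extend_bounded[of G "ball u r" u] r by auto
    have "isCont g u" using g(1) r(1)
      by (metis centre_in_ball continuous_on_eq_continuous_at holomorphic_on_imp_continuous_on open_ball)
    then have "g \<midarrow>u\<rightarrow> g u" by (simp add: isCont_def)
    moreover have "\<forall>\<^sub>F z in at u. g z = G z"
      using eventually_at_in_open[of "ball u r" u] r g(2) by (auto elim!: eventually_mono)
    ultimately show ?thesis using tendsto_cong by blast
  qed
  have "remove_sings G analytic_on {u}" for u
    using remove_sings_analytic_at[OF isoG] limG by blast
  then have "remove_sings G holomorphic_on UNIV"
    by (metis analytic_imp_holomorphic analytic_on_analytic_at)
  moreover have "bounded (range (remove_sings G))"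
    unfolding bounded_iff
  proof (intro exI ballI)
    fix y assume "y \<in> range (remove_sings G)"
    then obtain u where u: "y = remove_sings G u" by blast
    obtain L where L: "G \<midarrow>u\<rightarrow> L" using limG by blast
    then have "y = L" using u remove_sings_eqI by blast
    moreover have "norm L \<le> M"
      by (rule tendsto_upperbound[OF tendsto_norm[OF L]]) (use bound in \<open>auto simp: G_def\<close>)
    ultimately show "norm y \<le> M" by simp
  qed
  ultimately obtain \<mu> where \<mu>: "\<And>u. remove_sings G u = \<mu>"
    using Liouville_theorem unfolding constant_on_def by blast
  show ?thesis
  proof (rule that[of \<mu>])
    fix z assume z: "z \<noteq> 0" "F analytic_on {z}"
    then obtain u where u: "z = exp u" using exp_Ln by metis
    have "remove_sings G u = G u"
      using ana z u by (intro remove_sings_at_analytic) auto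
    then show "F z = \<mu>" using \<mu> u by (simp add: G_def)
  qed
qed

section \<open>The reciprocal of the elliptic function\<close>

lemma bounded_at_transfer:
  fixes F :: "complex \<Rightarrow> complex"
  assumes "\<exists>B. \<forall>\<^sub>F z in at w. norm (F z) \<le> B" "filterlim \<phi> (at w) (at w')"
    and "\<forall>\<^sub>F z in at w'. F (\<phi> z) = F z"
  shows "\<exists>B. \<forall>\<^sub>F z in at w'. norm (F z) \<le> B"
proof -
  obtain B where "\<forall>\<^sub>F z in at w. norm (F z) \<le> B" using assms(1) by blast
  then have "\<forall>\<^sub>F z in at w'. norm (F (\<phi> z)) \<le> B"
    using assms(2) by (auto simp: filterlim_iff)
  then have "\<forall>\<^sub>F z in at w'. norm (F z) \<le> B"
    using assms(3) by eventually_elim simp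
  then show ?thesis by blast
qed

lemma tendsto_imp_bounded_at:
  fixes F :: "complex \<Rightarrow> complex"
  assumes "(F \<longlongrightarrow> L) (at w)"
  shows "\<exists>B. \<forall>\<^sub>F z in at w. norm (F z) \<le> B"
proof -
  have "\<forall>\<^sub>F z in at w. norm (F z) < norm L + 1"
    by (rule order_tendstoD(2)[OF tendsto_norm[OF assms]]) simp
  then have "\<forall>\<^sub>F z in at w. norm (F z) \<le> norm L + 1"
    by eventually_elim simp
  then show ?thesis by blast
qed

text \<open>A zero cancels a pole of order at most one.\<close>
lemma zero_times_pole_bounded:
  fixes g p :: "complex \<Rightarrow> complex"
  assumes "g analytic_on {w}" "g w = 0" "((\<lambda>z. (z - w) * p z) \<longlongrightarrow> L) (at w)"
  shows "\<exists>B. \<forall>\<^sub>F z in at w. norm (g z * p z) \<le> B"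
proof -
  obtain g' where "(g has_field_derivative g') (at w)"
    using assms(1) analytic_on_imp_differentiable_at field_differentiable_def by blast
  then have "((\<lambda>z. (g z - g w) / (z - w)) \<longlongrightarrow> g') (at w)"
    by (simp add: has_field_derivative_iff)
  then have "((\<lambda>z. (g z - g w) / (z - w) * ((z - w) * p z)) \<longlongrightarrow> g' * L) (at w)"
    using assms(3) by (rule tendsto_mult)
  moreover have "\<forall>\<^sub>F z in at w. (g z - g w) / (z - w) * ((z - w) * p z) = g z * p z"
    using eventually_neq_at_within[of w w] by eventually_elim (simp add: assms(2))
  ultimately have "((\<lambda>z. g z * p z) \<longlongrightarrow> g' * L) (at w)"
    by (simp add: tendsto_cong)
  then show ?thesis by (rule tendsto_imp_bounded_at)
qed

lemma filterlim_at_times: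
  fixes s w :: complex
  assumes "s \<noteq> 0"
  shows "filterlim (\<lambda>z. s * z) (at (s * w)) (at w)"
proof (rule filterlim_atI)
  show "((\<lambda>z. s * z) \<longlongrightarrow> s * w) (at w)" by (intro tendsto_intros)
  show "\<forall>\<^sub>F z in at w. s * z \<noteq> s * w"
    using eventually_neq_at_within[of w w] by eventually_elim (use assms in auto)
qed

lemma filterlim_at_divide:
  fixes s w :: complex
  assumes "s \<noteq> 0"
  shows "filterlim (\<lambda>z. z / s) (at (w / s)) (at w)"
  using filterlim_at_times[of "1 / s" w] assms by simp

text \<open>Both factors are elliptic functions of order two. The first has poles at 1 and \<open>1 / c\<close> and zeros at \<open>a\<close> and \<open>1 / (c a)\<close>; the
  second has poles at \<open>a\<close> and \<open>1 / (c a)\<close>, and \<open>L\<close> is chosen such that it vanishes at 1 and \<open>1 / c\<close>. Hence the product has no poles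
  and is constant. The constant is not 0, since otherwise one of the factors would vanish identically.
  The condition on \<open>c * a\<^sup>2\<close> says that \<open>a\<close> and \<open>1 / (c a)\<close> are different modulo periods.\<close>
lemma dipole_sum_quotient_product_constant:
  assumes q: "q \<noteq> 0" "norm q < 1" and c: "c \<noteq> 0" "\<And>k. c * q powi k \<noteq> 1"
    and a: "off_poles q c a" "\<And>k. c * a\<^sup>2 * q powi k \<noteq> 1"
  obtains L \<mu> where "\<mu> \<noteq> 0"
    "\<And>z. \<lbrakk>off_poles q c z; off_poles q (c * a\<^sup>2) (z / a)\<rbrakk> \<Longrightarrow>
      (dipole_sum q c z - dipole_sum q c a) * (dipole_sum q (c * a\<^sup>2) (z / a) - L) = \<mu>"
proof -
  define d where "d = c * a\<^sup>2"
  define L where "L = dipole_sum q d (1 / a)"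
  define H where "H = (\<lambda>z. dipole_sum q d (z / a) - L)"
  define F where "F = (\<lambda>z. (dipole_sum q c z - dipole_sum q c a) * H z)"
  define good where "good = (\<lambda>z. off_poles q c z \<and> off_poles q d (z / a))"
  have a0: "a \<noteq> 0" using a(1) off_polesD by blast
  have d: "d \<noteq> 0" "\<And>k. d * q powi k \<noteq> 1"
    using a c a0 by (auto simp: d_def)
  have off1: "off_poles q d (1 / a)"
    unfolding off_poles_def
  proof (intro conjI allI)
    fix k :: int
    show "q powi k * (1 / a) \<noteq> 1"
      using off_polesD(2)[OF a(1), of "-k"] a0 q by (auto simp: power_int_minus field_simps)
    show "d * (q powi k * (1 / a)) \<noteq> 1"
      using off_polesD(3)[OF a(1), of k] a0 by (simp add: d_def power2_eq_square mult_ac)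
  qed (use a0 in simp)
  have Hana: "H analytic_on {z}" if "off_poles q d (z / a)" for z
  proof -
    have "dipole_sum q d analytic_on {z / a}"
      by (rule dipole_sum_analytic[OF q d(1) that])
    then have "(dipole_sum q d \<circ> (\<lambda>z. z / a)) analytic_on {z}"
      using a0 by (intro analytic_on_compose) (auto intro!: analytic_intros)
    then show ?thesis unfolding H_def o_def by (intro analytic_intros)
  qed
  have Cana: "(\<lambda>z. dipole_sum q c z - dipole_sum q c a) analytic_on {z}" if "off_poles q c z" for z
    using dipole_sum_analytic[OF q c(1) that] by (intro analytic_intros)
  have Fana: "F analytic_on {z}" if "good z" for z
    unfolding F_def using that Hana Cana by (intro analytic_on_mult) (auto simp: good_def)
  have ev_good: "\<forall>\<^sub>F z in at w. good z" if "w \<noteq> 0" for w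
  proof -
    have "\<forall>\<^sub>F z in at (w / a). off_poles q d z"
      using that a0 by (intro eventually_off_poles[OF q d(1)]) auto
    then have "\<forall>\<^sub>F z in at w. off_poles q d (z / a)"
      using filterlim_at_divide[OF a0, of w] by (auto simp: filterlim_iff)
    with eventually_off_poles[OF q c(1) that] show ?thesis
      unfolding good_def by (rule eventually_conj)
  qed
  have per: "F (q * z) = F z" for z
    using dipole_sum_times_q[OF q(1), of c z] dipole_sum_times_q[OF q(1), of d "z / a"] by (simp add: F_def H_def)
  \<comment> \<open>The singular points are the orbits of 1 and \<open>a\<close> under periods and involution, so these two suffice.\<close>
  define bdd where "bdd = (\<lambda>w. \<exists>B. \<forall>\<^sub>F z in at w. norm (F z) \<le> B)"
  have bdd_1: "bdd 1"
  proof -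
    have "((\<lambda>z. (z - 1) * dipole_sum q c z - (z - 1) * dipole_sum q c a) \<longlongrightarrow> -1 - (1 - 1) * dipole_sum q c a) (at 1)"
      by (intro tendsto_intros dipole_sum_pole_at_1_residue q c)
    then have "((\<lambda>z. (z - 1) * (dipole_sum q c z - dipole_sum q c a)) \<longlongrightarrow> -1) (at 1)"
      by (simp add: algebra_simps)
    then show ?thesis
      unfolding bdd_def F_def using zero_times_pole_bounded[OF Hana[of 1]] off1
      by (simp add: H_def L_def mult.commute)
  qed
  have H_pole: "((\<lambda>z. (z - a) * H z) \<longlongrightarrow> - a) (at a)"
  proof -
    have "((\<lambda>z. (z / a - 1) * dipole_sum q d (z / a)) \<longlongrightarrow> -1) (at a)"
      using filterlim_compose[OF dipole_sum_pole_at_1_residue[OF q d], of "\<lambda>z. z / a" "at a"]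
        filterlim_at_divide[OF a0, of a] a0 by simp
    then have "((\<lambda>z. a * ((z / a - 1) * dipole_sum q d (z / a)) - (z - a) * L) \<longlongrightarrow> a * (-1) - (a - a) * L) (at a)"
      by (intro tendsto_intros)
    moreover have "a * ((z / a - 1) * dipole_sum q d (z / a)) - (z - a) * L = (z - a) * H z" for z
    proof -
      have "a * (z / a - 1) = z - a" using a0 by (simp add: field_simps)
      then show ?thesis by (simp add: H_def right_diff_distrib flip: mult.assoc)
    qed
    ultimately show ?thesis by simp
  qed
  have bdd_a: "bdd a"
    unfolding bdd_def F_def by (rule zero_times_pole_bounded[OF Cana[OF a(1)] _ H_pole]) simp
  have bdd_powi: "bdd (q powi k * w)" if "bdd w" for k w
    unfolding bdd_def
  proof (rule bounded_at_transfer)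
    show "filterlim (\<lambda>z. q powi (-k) * z) (at w) (at (q powi k * w))"
    proof -
      have "q powi (-k) * (q powi k * w) = w" "q powi (-k) \<noteq> 0"
        using q by (simp_all add: power_int_minus)
      then show ?thesis using filterlim_at_times[of "q powi (-k)" "q powi k * w"] by metis
    qed
    show "\<forall>\<^sub>F z in at (q powi k * w). F (q powi (-k) * z) = F z"
      using powi_invariant[where f = F, OF q(1) per] by simp
  qed (use that in \<open>simp add: bdd_def\<close>)
  have bdd_reflect: "bdd (1 / (c * w))" if "bdd w" "w \<noteq> 0" for w
    unfolding bdd_def
  proof (rule bounded_at_transfer)
    let ?w = "1 / (c * w)"
    have w: "?w \<noteq> 0" "1 / (c * ?w) = w" using that c by auto
    show "filterlim (\<lambda>z. 1 / (c * z)) (at w) (at ?w)"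
    proof (rule filterlim_atI)
      have "((\<lambda>z. 1 / (c * z)) \<longlongrightarrow> 1 / (c * ?w)) (at ?w)"
        using c w by (intro tendsto_intros) auto
      then show "((\<lambda>z. 1 / (c * z)) \<longlongrightarrow> w) (at ?w)" unfolding w .
      show "\<forall>\<^sub>F z in at ?w. 1 / (c * z) \<noteq> w"
        using eventually_neq_at_within[of ?w ?w] by eventually_elim (use that c in auto)
    qed
    show "\<forall>\<^sub>F z in at ?w. F (1 / (c * z)) = F z"
      using ev_good[OF w(1)]
    proof eventually_elim
      case (elim z)
      have "1 / (c * z) / a = 1 / (d * (z / a))"
        using a0 by (simp add: d_def power2_eq_square)
      then show ?case
        using elim dipole_sum_reflect[OF q(1) c(1), of z] dipole_sum_reflect[OF q(1) d(1), of "z / a"]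
        by (simp add: F_def H_def good_def)
    qed
  qed (use that in \<open>simp add: bdd_def\<close>)
  have bdd: "bdd w" if w: "w \<noteq> 0" for w
  proof (cases "good w")
    case True
    then have "isCont F w" using Fana analytic_at_imp_isCont by blast
    then show ?thesis unfolding bdd_def isCont_def by (rule tendsto_imp_bounded_at)
  next
    case False
    then consider k where "q powi k * w = 1" | k where "c * (q powi k * w) = 1"
      | k where "q powi k * (w / a) = 1" | k where "d * (q powi k * (w / a)) = 1"
      using w a0 unfolding good_def off_poles_def by auto
    then show ?thesis
    proof cases
      case 1
      then have "w = q powi (-k) * 1" using q by (simp add: power_int_minus field_simps)
      then show ?thesis using bdd_powi[OF bdd_1] by metis
    next
      case 2
      then have "w = q powi (-k) * (1 / (c * 1))" using q c by (simp add: power_int_minus field_simps)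
      then show ?thesis using bdd_powi[OF bdd_reflect[OF bdd_1]] by (metis one_neq_zero)
    next
      case 3
      then have "w = q powi (-k) * a" using q a0 by (simp add: power_int_minus field_simps)
      then show ?thesis using bdd_powi[OF bdd_a] by metis
    next
      case 4
      then have "w = q powi (-k) * (1 / (c * a))" using q a0 c
        by (simp add: power_int_minus field_simps d_def power2_eq_square)
      then show ?thesis using bdd_powi[OF bdd_reflect[OF bdd_a a0]] by metis
    qed
  qed
  have iso: "\<forall>\<^sub>F z in at w. F analytic_on {z}" if "w \<noteq> 0" for w
    using ev_good[OF that] by eventually_elim (rule Fana)
  obtain \<mu> where \<mu>: "\<And>z. z \<noteq> 0 \<Longrightarrow> F analytic_on {z} \<Longrightarrow> F z = \<mu>"
    using elliptic_Liouville[OF q per iso] bdd unfolding bdd_def by blast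
  have F\<mu>: "F z = \<mu>" if "good z" for z
    using \<mu> Fana that off_polesD(1) unfolding good_def by blast
  have "\<mu> \<noteq> 0"
  proof
    assume "\<mu> = 0"
    \<comment> \<open>Near its pole 1 the first factor is not 0, so there the second one is; it then vanishes identically, although
      it has a pole at \<open>a\<close>.\<close>
    have ev0: "\<forall>\<^sub>F z in at 1. H z = 0 \<and> good z"
    proof -
      have "((\<lambda>z. (z - 1) * dipole_sum q c z - (z - 1) * dipole_sum q c a) \<longlongrightarrow> -1 - (1 - 1) * dipole_sum q c a) (at 1)"
        by (intro tendsto_intros dipole_sum_pole_at_1_residue q c)
      then have "\<forall>\<^sub>F z in at 1. (z - 1) * dipole_sum q c z - (z - 1) * dipole_sum q c a \<noteq> 0"
        by (rule tendsto_imp_eventually_ne) simp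
      with ev_good[of 1, OF one_neq_zero] show ?thesis
        by eventually_elim (use F\<mu> \<open>\<mu> = 0\<close> in \<open>auto simp: F_def\<close>)
    qed
    have U_open: "open {z. good z}"
    proof -
      have "open ({z. off_poles q c z} \<inter> (\<lambda>z. z / a) -` {z. off_poles q d z})"
        using a0 by (intro open_Int open_vimage open_off_poles q c d continuous_intros) auto
      also have "{z. off_poles q c z} \<inter> (\<lambda>z. z / a) -` {z. off_poles q d z} = {z. good z}"
        by (auto simp: good_def)
      finally show ?thesis .
    qed
    have U_conn: "connected {z. good z}"
    proof -
      define T where "T = {0} \<union> (\<Union>k. {1 / q powi k, 1 / (c * q powi k), a / q powi k, a / (d * q powi k)})"
      have "countable T" unfolding T_def by auto
      moreover have "{z. good z} = UNIV - T"
        using q c d a0 unfolding T_def good_def off_poles_def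
        by (auto simp: field_simps)
      ultimately show ?thesis
        by (auto intro!: connected_open_diff_countable)
    qed
    obtain e where e: "e > 0" "\<And>z. z \<in> ball 1 e - {1} \<Longrightarrow> H z = 0 \<and> good z"
      using ev0 unfolding eventually_at by (force simp: dist_commute)
    have "H z = 0" if "good z" for z
    proof (rule analytic_continuation_open[where s = "ball 1 e - {1}" and s' = "{z. good z}" and f = H and g = "\<lambda>_. 0" and z = z])
      have "1 + of_real (e / 2) \<in> ball (1::complex) e - {1}"
        using e(1) by (simp add: dist_norm)
      then show "ball (1::complex) e - {1} \<noteq> {}" by blast
      show "H holomorphic_on {z. good z}"
        using Hana by (intro analytic_imp_holomorphic) (auto simp: analytic_on_def good_def)
    qed (use e U_open U_conn that in auto)
    then have "\<forall>\<^sub>F z in at a. (z - a) * H z = 0"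
      using ev_good[OF a0] by (auto elim!: eventually_mono)
    then have "((\<lambda>z. (z - a) * H z) \<longlongrightarrow> 0) (at a)"
      by (rule tendsto_eventually)
    then show False
      using H_pole a0 tendsto_unique[OF trivial_limit_at] by fastforce
  qed
  then show ?thesis
    using F\<mu> by (intro that[of \<mu> L]) (auto simp: F_def H_def good_def d_def)
qed

section \<open>Orbits, translates and isogenies\<close>

text \<open>If \<open>z\<close> is in neither orbit, then both factors in \<open>dipole_sum_quotient_product_constant\<close> are finite and the first is 0,
  while the product is not.\<close>
lemma dipole_sum_eq_imp_orbit:
  assumes q: "q \<noteq> 0" "norm q < 1" and c: "c \<noteq> 0" "\<And>k. c * q powi k \<noteq> 1"
    and a: "off_poles q c a" "\<And>k. c * a\<^sup>2 * q powi k \<noteq> 1"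
    and z: "off_poles q c z" "dipole_sum q c z = dipole_sum q c a"
  obtains k where "z = q powi k * a" | k where "z = q powi k * (1 / (c * a))"
proof -
  obtain L \<mu> where "\<mu> \<noteq> 0"
    "\<And>z. \<lbrakk>off_poles q c z; off_poles q (c * a\<^sup>2) (z / a)\<rbrakk> \<Longrightarrow>
      (dipole_sum q c z - dipole_sum q c a) * (dipole_sum q (c * a\<^sup>2) (z / a) - L) = \<mu>"
    by (rule dipole_sum_quotient_product_constant[OF q c a]) blast
  then have "\<not> off_poles q (c * a\<^sup>2) (z / a)"
    using z by force
  moreover have za: "z \<noteq> 0" "a \<noteq> 0" using a z off_polesD(1) by auto
  ultimately consider k where "q powi k * (z / a) = 1" | k where "c * a\<^sup>2 * (q powi k * (z / a)) = 1"
    unfolding off_poles_def by auto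
  then show ?thesis
  proof cases
    case 1
    then have "z = q powi (-k) * a" using q za by (simp add: power_int_minus field_simps)
    then show ?thesis by (rule that(1))
  next
    case 2
    then have "z = q powi (-k) * (1 / (c * a))" using q za c
      by (simp add: power_int_minus field_simps power2_eq_square)
    then show ?thesis by (rule that(2))
  qed
qed

text \<open>The left-hand side has poles at the four points \<open>1 / \<rho>\<close>, \<open>1 / (c \<rho>)\<close>, \<open>\<rho>\<close> and \<open>\<rho> / c\<close>. On
  the right they are grouped into pairs that the involution \<open>z \<mapsto> 1 / (c z)\<close> exchanges, which makes each summand a
  function of \<open>dipole_sum q c z\<close>. The identity holds term by term.\<close>
lemma dipole_sum_add_translates:
  assumes q: "q \<noteq> 0" "norm q < 1" and c: "c \<noteq> 0" and "\<rho> \<noteq> 0" "z \<noteq> 0"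
  shows "dipole_sum q c (\<rho> * z) + dipole_sum q c (z / \<rho>) = dipole_sum q (c * \<rho>\<^sup>2) (z / \<rho>) + dipole_sum q (c / \<rho>\<^sup>2) (\<rho> * z)"
proof -
  have "dipole_sum q c (\<rho> * z) + dipole_sum q c (z / \<rho>)
      = (\<Sum>\<^sub>\<infinity>k. dipole c (q powi k * (\<rho> * z)) + dipole c (q powi k * (z / \<rho>)))"
    unfolding dipole_sum_def by (intro infsum_add[symmetric] dipole_summable) (use assms in auto)
  also have "\<dots> = (\<Sum>\<^sub>\<infinity>k. dipole (c * \<rho>\<^sup>2) (q powi k * (z / \<rho>)) + dipole (c / \<rho>\<^sup>2) (q powi k * (\<rho> * z)))"
  proof (intro infsum_cong)
    fix k :: int
    have "c * \<rho>\<^sup>2 * (q powi k * (z / \<rho>)) = c * (q powi k * (\<rho> * z))"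
      "c / \<rho>\<^sup>2 * (q powi k * (\<rho> * z)) = c * (q powi k * (z / \<rho>))"
      using \<open>\<rho> \<noteq> 0\<close> by (simp_all add: power2_eq_square)
    then show "dipole c (q powi k * (\<rho> * z)) + dipole c (q powi k * (z / \<rho>))
      = dipole (c * \<rho>\<^sup>2) (q powi k * (z / \<rho>)) + dipole (c / \<rho>\<^sup>2) (q powi k * (\<rho> * z))"
      unfolding dipole_def by simp
  qed
  also have "\<dots> = dipole_sum q (c * \<rho>\<^sup>2) (z / \<rho>) + dipole_sum q (c / \<rho>\<^sup>2) (\<rho> * z)"
    unfolding dipole_sum_def by (intro infsum_add dipole_summable) (use assms in auto)
  finally show ?thesis .
qed

lemma sum_symmetric_int:
  fixes f :: "int \<Rightarrow> 'a::comm_monoid_add"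
  shows "(\<Sum>j=-n..n. f (-j)) = (\<Sum>j=-n..n. f j)"
  by (rule sum.reindex_bij_witness[of _ uminus uminus]) auto

text \<open>The range of summation is a complete residue system modulo \<open>2 m + 1\<close>.\<close>
lemma sum_shift_periodic:
  fixes f :: "int \<Rightarrow> 'a::ab_group_add" and m :: nat
  assumes per: "\<And>k. f (k + (2 * int m + 1)) = f k"
  shows "(\<Sum>k=-int m..int m. f (s + k)) = (\<Sum>k=-int m..int m. f k)"
proof -
  define F where "F = (\<lambda>s. \<Sum>k=-int m..int m. f (s + k))"
  have step: "F (s + 1) = F s" for s
  proof -
    have "F (s + 1) = (\<Sum>k\<in>{-int m+1..int m+1}. f (s + k))"
      unfolding F_def by (rule sum.reindex_bij_witness[of _ "\<lambda>k. k - 1" "\<lambda>k. k + 1"]) (auto simp: algebra_simps)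
    also have "{-int m+1..int m+1} = insert (int m + 1) {-int m+1..int m}" by auto
    also have "(\<Sum>k\<in>\<dots>. f (s + k)) = f (s + (int m + 1)) + (\<Sum>k\<in>{-int m+1..int m}. f (s + k))"
      by simp
    also have "f (s + (int m + 1)) = f (s - int m)"
      using per[of "s - int m"] by (simp add: algebra_simps)
    also have "f (s - int m) + (\<Sum>k\<in>{-int m+1..int m}. f (s + k)) = (\<Sum>k\<in>insert (-int m) {-int m+1..int m}. f (s + k))"
      by simp
    also have "insert (-int m) {-int m+1..int m} = {-int m..int m}" by auto
    finally show ?thesis by (simp add: F_def)
  qed
  have pos: "F (int n) = F 0" for n
  proof (induction n)
    case (Suc n)
    then show ?case using step[of "int n"] by (simp add: add.commute)
  qed simp
  have neg: "F (- int n) = F 0" for n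
  proof (induction n)
    case (Suc n)
    then show ?case using step[of "- int (Suc n)"] by simp
  qed simp
  have "F s = F 0"
    by (cases s rule: int_cases2) (simp_all add: pos neg)
  then show ?thesis by (simp add: F_def)
qed

lemma dipole_sum_sum_translates:
  assumes q: "q \<noteq> 0" "norm q < 1" and c: "c \<noteq> 0" and d: "d \<noteq> 0" "z \<noteq> 0"
  shows "(\<Sum>j=-n..n. dipole_sum q c (d powi j * z)) = (\<Sum>j=-n..n. dipole_sum q (c * (d powi j)\<^sup>2) (z / d powi j))"
proof -
  let ?A = "\<lambda>j. dipole_sum q c (d powi j * z)" and ?B = "\<lambda>j. dipole_sum q (c * (d powi j)\<^sup>2) (z / d powi j)"
  have "?A j + ?A (-j) = ?B j + ?B (-j)" for j
    using dipole_sum_add_translates[OF q c, of "d powi j" z] d by (simp add: power_int_minus field_simps)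
  then have "(\<Sum>j=-n..n. ?A j + ?A (-j)) = (\<Sum>j=-n..n. ?B j + ?B (-j))"
    by (intro sum.cong refl)
  then have "(\<Sum>j=-n..n. ?A j) + (\<Sum>j=-n..n. ?A j) = (\<Sum>j=-n..n. ?B j) + (\<Sum>j=-n..n. ?B j)"
    using sum_symmetric_int[of ?A n] sum_symmetric_int[of ?B n] by (simp only: sum.distrib)
  then show ?thesis by simp
qed

text \<open>Here \<open>d\<close> is thought of as a point of order \<open>2 m + 1\<close> on the curve. The translates are regrouped by
  \<open>dipole_sum_sum_translates\<close>; the summand for \<open>j\<close> then has its poles at \<open>d\<^sup>j\<close> and \<open>1 / (c d\<^sup>j)\<close>, so by
  \<open>dipole_sum_quotient_product_constant\<close> it is a simple fraction in \<open>U\<close> with pole \<open>U (d\<^sup>j)\<close>. The affine coordinate \<open>U\<close> instead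
  of \<open>dipole_sum q c\<close> allows for a real coordinate later.\<close>
lemma dipole_sum_partial_fractions:
  fixes m :: nat and \<alpha> \<beta> :: complex
  assumes q: "q \<noteq> 0" "norm q < 1" and c: "c \<noteq> 0" and d: "d \<noteq> 0"
    and d_indep: "\<And>j k. \<lbrakk>j \<noteq> 0; \<bar>j\<bar> \<le> 2 * int m\<rbrakk> \<Longrightarrow> d powi j \<noteq> q powi k"
    and c_indep: "\<And>j k. c * d powi j * q powi k \<noteq> 1"
    and \<alpha>: "\<alpha> \<noteq> 0"
  defines "U \<equiv> \<lambda>z. \<alpha> * dipole_sum q c z + \<beta>"
  defines "T \<equiv> (\<lambda>j. U (d powi j)) ` ({-int m..int m} - {0})"
  obtains \<kappa> r where "\<And>t. t \<in> T \<Longrightarrow> r t \<noteq> 0" "card T = 2 * m"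
    "\<And>z. (\<And>j. \<bar>j\<bar> \<le> int m \<Longrightarrow> off_poles q c (d powi j * z)) \<Longrightarrow>
      U z \<notin> T \<and> \<alpha> * (\<Sum>j=-int m..int m. dipole_sum q c (d powi j * z)) = U z + \<kappa> + (\<Sum>t\<in>T. r t / (U z - t))"
proof -
  define J where "J = {-int m..int m} - {0}"
  define a where "a = (\<lambda>j::int. d powi j)"
  have c': "c * q powi k \<noteq> 1" for k using c_indep[of 0 k] by simp
  have off_a: "off_poles q c (a j)" if "j \<in> J" for j
    unfolding off_poles_def
  proof (intro conjI allI)
    fix k :: int
    show "q powi k * a j \<noteq> 1"
    proof
      assume "q powi k * a j = 1"
      then have "d powi j = q powi (-k)"
        using q by (simp add: a_def power_int_minus field_simps)
      moreover have "j \<noteq> 0" "\<bar>j\<bar> \<le> 2 * int m" using that by (auto simp: J_def)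
      ultimately show False using d_indep by blast
    qed
    show "c * (q powi k * a j) \<noteq> 1"
      using c_indep[of j k] by (simp add: a_def mult_ac)
  qed (use d in \<open>simp add: a_def\<close>)
  have ca: "c * (a j)\<^sup>2 * q powi k \<noteq> 1" for j k
    using c_indep[of "2 * j" k] by (simp add: a_def power_int_mult mult.commute[of 2])
  have inj: "inj_on (\<lambda>j. U (a j)) J"
  proof (rule inj_onI)
    fix i j assume ij: "i \<in> J" "j \<in> J" "U (a i) = U (a j)"
    then have "dipole_sum q c (a i) = dipole_sum q c (a j)" using \<alpha> by (simp add: U_def)
    then consider k where "a i = q powi k * a j" | k where "a i = q powi k * (1 / (c * a j))"
      using dipole_sum_eq_imp_orbit[OF q c c' off_a[OF ij(2)] ca off_a[OF ij(1)]] by metis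
    then show "i = j"
    proof cases
      case (1 k)
      then have "d powi (i - j) = q powi k" using d by (simp add: a_def power_int_diff)
      moreover have "\<bar>i - j\<bar> \<le> 2 * int m" using ij by (auto simp: J_def)
      ultimately show ?thesis using d_indep[of "i - j" k] by auto
    next
      case (2 k)
      then have "c * d powi (i + j) * q powi (-k) = 1"
        using c d q by (simp add: a_def power_int_add power_int_minus field_simps)
      then show ?thesis using c_indep by blast
    qed
  qed
  have "\<forall>j\<in>J. \<exists>L \<mu>. \<mu> \<noteq> 0 \<and> (\<forall>z. off_poles q c z \<longrightarrow> off_poles q (c * (a j)\<^sup>2) (z / a j) \<longrightarrow>
      (dipole_sum q c z - dipole_sum q c (a j)) * (dipole_sum q (c * (a j)\<^sup>2) (z / a j) - L) = \<mu>)"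
    using dipole_sum_quotient_product_constant[OF q c c' off_a ca] by metis
  then obtain L \<mu> where L\<mu>: "\<And>j. j \<in> J \<Longrightarrow> \<mu> j \<noteq> 0"
    "\<And>j z. \<lbrakk>j \<in> J; off_poles q c z; off_poles q (c * (a j)\<^sup>2) (z / a j)\<rbrakk> \<Longrightarrow>
      (dipole_sum q c z - dipole_sum q c (a j)) * (dipole_sum q (c * (a j)\<^sup>2) (z / a j) - L j) = \<mu> j"
    by metis
  have T: "T = (\<lambda>j. U (a j)) ` J" by (simp add: T_def J_def a_def)
  define r where "r = (\<lambda>t. \<alpha>\<^sup>2 * \<mu> (the_inv_into J (\<lambda>j. U (a j)) t))"
  have r: "r (U (a j)) = \<alpha>\<^sup>2 * \<mu> j" if "j \<in> J" for j
    using the_inv_into_f_f[OF inj that] by (simp add: r_def)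
  show ?thesis
  proof (rule that[of r "\<alpha> * (\<Sum>j\<in>J. L j) - \<beta>"])
    show "r t \<noteq> 0" if "t \<in> T" for t
      using that L\<mu>(1) \<alpha> r by (auto simp: T)
    show "card T = 2 * m"
      unfolding T using inj by (simp add: card_image J_def)
    fix z assume z: "\<And>j. \<bar>j\<bar> \<le> int m \<Longrightarrow> off_poles q c (d powi j * z)"
    have z0: "off_poles q c z" "z \<noteq> 0"
      using z[of 0] by (auto simp: off_poles_def)
    have off: "off_poles q (c * (a j)\<^sup>2) (z / a j)" if "j \<in> J" for j
      unfolding off_poles_def
    proof (intro conjI allI)
      fix k :: int
      have "\<bar>-j\<bar> \<le> int m" "\<bar>j\<bar> \<le> int m" using that by (auto simp: J_def)
      note zj = off_polesD(2)[OF z[OF this(1)], of k] off_polesD(3)[OF z[OF this(2)], of k]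
      show "q powi k * (z / a j) \<noteq> 1"
        using zj(1) d by (simp add: a_def power_int_minus field_simps)
      have "c * (a j)\<^sup>2 * (q powi k * (z / a j)) = c * (q powi k * (d powi j * z))"
        using d by (simp add: a_def power2_eq_square)
      with zj(2) show "c * (a j)\<^sup>2 * (q powi k * (z / a j)) \<noteq> 1" by simp
    qed (use z0 d in \<open>simp add: a_def\<close>)
    have Uj: "U z \<noteq> U (a j)" if "j \<in> J" for j
      using L\<mu>(1)[OF that] L\<mu>(2)[OF that z0(1) off[OF that]] \<alpha> by (auto simp: U_def)
    have term_j: "\<alpha> * dipole_sum q (c * (a j)\<^sup>2) (z / a j) = \<alpha> * L j + r (U (a j)) / (U z - U (a j))" if "j \<in> J" for j
    proof -
      have "(U z - U (a j)) * (\<alpha> * dipole_sum q (c * (a j)\<^sup>2) (z / a j) - \<alpha> * L j)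
          = \<alpha>\<^sup>2 * ((dipole_sum q c z - dipole_sum q c (a j)) * (dipole_sum q (c * (a j)\<^sup>2) (z / a j) - L j))"
        by (simp add: U_def power2_eq_square algebra_simps)
      also have "\<dots> = r (U (a j))"
        using L\<mu>(2)[OF that z0(1) off[OF that]] r[OF that] by simp
      finally show ?thesis
        using Uj[OF that] by (simp add: field_simps)
    qed
    have "\<alpha> * (\<Sum>j=-int m..int m. dipole_sum q c (d powi j * z))
        = (\<Sum>j=-int m..int m. \<alpha> * dipole_sum q (c * (a j)\<^sup>2) (z / a j))"
      unfolding a_def dipole_sum_sum_translates[OF q c d z0(2)] sum_distrib_left ..
    also have "\<dots> = \<alpha> * dipole_sum q c z + (\<Sum>j\<in>J. \<alpha> * dipole_sum q (c * (a j)\<^sup>2) (z / a j))"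
      unfolding J_def by (subst sum.remove[of _ 0]) (auto simp: a_def)
    also have "(\<Sum>j\<in>J. \<alpha> * dipole_sum q (c * (a j)\<^sup>2) (z / a j)) = (\<Sum>j\<in>J. \<alpha> * L j + r (U (a j)) / (U z - U (a j)))"
      by (intro sum.cong refl term_j)
    also have "\<dots> = \<alpha> * (\<Sum>j\<in>J. L j) + (\<Sum>t\<in>T. r t / (U z - t))"
      unfolding T sum.reindex[OF inj] by (simp add: sum.distrib sum_distrib_left)
    finally show "U z \<notin> T \<and> \<alpha> * (\<Sum>j=-int m..int m. dipole_sum q c (d powi j * z))
        = U z + (\<alpha> * (\<Sum>j\<in>J. L j) - \<beta>) + (\<Sum>t\<in>T. r t / (U z - t))"
      using Uj by (auto simp: T U_def)
  qed
qed

text \<open>A sum over powers of \<open>g\<close> is split according to the residue of the exponent modulo \<open>2 m + 1\<close>. This is the isogeny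
  from \<open>\<complex>\<^sup>* / g\<^bsup>(2m+1)\<int>\<^esup>\<close> to \<open>\<complex>\<^sup>* / g\<^bsup>\<int>\<^esup>\<close>.\<close>
lemma dipole_sum_refine:
  fixes m :: nat
  assumes g: "g \<noteq> 0" "norm g < 1" and c: "c \<noteq> 0" and z: "z \<noteq> 0"
  shows "(\<Sum>j=-int m..int m. dipole_sum (g ^ (2 * m + 1)) c (g powi j * z)) = dipole_sum g c z"
proof -
  define l where "l = 2 * int m + 1"
  let ?J = "{-int m..int m}"
  define f where "f = (\<lambda>k. dipole c (g powi k * z))"
  have divmod: "(j + l * n + int m) div l = n" "(j + l * n + int m) mod l = j + int m" if "j \<in> ?J" for j n
    using that by (auto simp: l_def int_div_pos_eq int_mod_pos_eq)
  have bij: "bij_betw (\<lambda>(j, n). j + l * n) (?J \<times> UNIV) UNIV"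
  proof (rule bij_betw_byWitness[where f' = "\<lambda>k. ((k + int m) mod l - int m, (k + int m) div l)"])
    show "\<forall>a\<in>?J \<times> UNIV. (\<lambda>k. ((k + int m) mod l - int m, (k + int m) div l)) ((\<lambda>(j, n). j + l * n) a) = a"
      by (clarsimp simp: divmod simp del: atLeastAtMost_iff)
    show "\<forall>k\<in>UNIV. (\<lambda>(j, n). j + l * n) ((k + int m) mod l - int m, (k + int m) div l) = k"
    proof
      fix k :: int
      show "(\<lambda>(j, n). j + l * n) ((k + int m) mod l - int m, (k + int m) div l) = k"
        using mod_mult_div_eq[of "k + int m" l] by (simp only: prod.case)
    qed
    show "(\<lambda>k. ((k + int m) mod l - int m, (k + int m) div l)) ` UNIV \<subseteq> ?J \<times> UNIV"
    proof -
      have "0 \<le> (k + int m) mod l \<and> (k + int m) mod l < l" for k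
        using pos_mod_bound[of l] pos_mod_sign[of l] by (simp add: l_def)
      then show ?thesis by (force simp: l_def)
    qed
  qed auto
  have "f summable_on UNIV"
    unfolding f_def by (rule dipole_summable[OF g c z])
  then have summ: "(\<lambda>x. f (case x of (j, n) \<Rightarrow> j + l * n)) summable_on (?J \<times> UNIV)"
    by (subst summable_on_reindex_bij_betw[OF bij])
  have "dipole_sum g c z = infsum f UNIV" by (simp add: dipole_sum_def f_def)
  also have "\<dots> = (\<Sum>\<^sub>\<infinity>x\<in>?J \<times> UNIV. f (case x of (j, n) \<Rightarrow> j + l * n))"
    by (rule infsum_reindex_bij_betw[OF bij, symmetric])
  also have "\<dots> = (\<Sum>\<^sub>\<infinity>j\<in>?J. \<Sum>\<^sub>\<infinity>n. f (j + l * n))"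
    using infsum_Sigma'_banach[of "\<lambda>j n. f (j + l * n)" ?J "\<lambda>_. UNIV"] summ
    by (simp add: case_prod_unfold)
  also have "\<dots> = (\<Sum>j\<in>?J. \<Sum>\<^sub>\<infinity>n. f (j + l * n))" by simp
  also have "\<dots> = (\<Sum>j\<in>?J. dipole_sum (g ^ (2 * m + 1)) c (g powi j * z))"
  proof (intro sum.cong refl)
    fix j
    have "g powi (j + l * n) * z = (g ^ (2 * m + 1)) powi n * (g powi j * z)" for n
    proof -
      have "(g ^ (2 * m + 1)) powi n = g powi (l * n)"
        by (simp only: power_int_mult l_def) (simp add: power_int_def nat_add_distrib nat_mult_distrib)
      then show ?thesis using g by (simp add: power_int_add)
    qed
    then show "(\<Sum>\<^sub>\<infinity>n. f (j + l * n)) = dipole_sum (g ^ (2 * m + 1)) c (g powi j * z)"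
      unfolding f_def dipole_sum_def by (simp only:)
  qed
  finally show ?thesis ..
qed

section \<open>The real structure\<close>

text \<open>When \<open>q = c\<^sup>2\<close>, translation by \<open>c\<close> exchanges the two classes of poles with a change of sign of the residues, so
  the sum of the two translates is constant. The terms telescope, and the constant \<open>- 1\<close> is the difference of the
  limits 0 and 1 of \<open>1 / (1 - t)\<close> at infinity and at 0.\<close>
lemma dipole_sum_half_period:
  assumes c: "c \<noteq> 0" "norm c < 1" and z: "off_poles (c\<^sup>2) c z"
  shows "dipole_sum (c\<^sup>2) c z + dipole_sum (c\<^sup>2) c (z / c) = - 1"
proof -
  define q where "q = c\<^sup>2"
  have q: "q \<noteq> 0" "norm q < 1"
    using c by (auto simp: q_def norm_power power_less_one_iff)
  have z0: "z \<noteq> 0" using z off_polesD by blast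
  define \<beta> where "\<beta> = (\<lambda>k::int. 1 / (1 - q powi k * (z / c)))"
  have term_eq: "dipole c (q powi k * z) + dipole c (q powi k * (z / c)) = \<beta> k - \<beta> (k + 1)" for k
  proof -
    have "c * (q powi k * z) = q powi (k + 1) * (z / c)" "c * (q powi k * (z / c)) = q powi k * z"
      using c by (simp_all add: q_def power_int_add power2_eq_square)
    then show ?thesis by (simp add: dipole_def \<beta>_def)
  qed
  have summ: "(\<lambda>k. dipole c (q powi k * z)) summable_on UNIV" "(\<lambda>k. dipole c (q powi k * (z / c))) summable_on UNIV"
    by (intro dipole_summable[OF q]; use c z0 in simp)+
  define s where "s = dipole_sum q c z + dipole_sum q c (z / c)"
  have "((\<lambda>k. \<beta> k - \<beta> (k + 1)) has_sum s) UNIV"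
    unfolding s_def dipole_sum_def term_eq[symmetric] using summ by (intro has_sum_add has_sum_infsum)
  then have "(sum (\<lambda>k. \<beta> k - \<beta> (k + 1)) \<longlongrightarrow> s) (finite_subsets_at_top UNIV)"
    by (simp add: has_sum_def)
  moreover have "filterlim (\<lambda>n. {-int n..int n}) (finite_subsets_at_top UNIV) sequentially"
    unfolding filterlim_finite_subsets_at_top
  proof (intro allI impI)
    fix A :: "int set" assume A: "finite A \<and> A \<subseteq> UNIV"
    have "\<forall>\<^sub>F n in sequentially. \<forall>k\<in>A. nat \<bar>k\<bar> \<le> n"
      using A by (intro eventually_ball_finite ballI eventually_ge_at_top) auto
    then show "\<forall>\<^sub>F n in sequentially. finite {-int n..int n} \<and> A \<subseteq> {-int n..int n} \<and> {-int n..int n} \<subseteq> UNIV"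
      by eventually_elim force
  qed
  ultimately have lim_s: "(\<lambda>n. \<Sum>k=-int n..int n. \<beta> k - \<beta> (k + 1)) \<longlonglongrightarrow> s"
    by (rule filterlim_compose)
  have tele: "(\<Sum>k=-int n..int n. \<beta> k - \<beta> (k + 1)) = \<beta> (- int n) - \<beta> (int n + 1)" for n
  proof (induction n)
    case (Suc n)
    have "{-int (Suc n)..int (Suc n)} = insert (- int (Suc n)) (insert (int (Suc n)) {-int n..int n})"
      by auto
    then have "(\<Sum>k=-int (Suc n)..int (Suc n). \<beta> k - \<beta> (k + 1))
        = (\<beta> (- int (Suc n)) - \<beta> (- int (Suc n) + 1))
          + ((\<beta> (int (Suc n)) - \<beta> (int (Suc n) + 1)) + (\<beta> (- int n) - \<beta> (int n + 1)))"
      by (simp only: Suc.IH[symmetric]) (subst sum.insert; simp)+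
    moreover have "- int (Suc n) + 1 = - int n" "int n + 1 = int (Suc n)" by simp_all
    ultimately show ?case by (simp only:) simp
  qed simp
  have qlim: "(\<lambda>n. q ^ n) \<longlonglongrightarrow> 0"
    using q by (intro LIMSEQ_power_zero) auto
  have "(\<lambda>n. 1 / (1 - q ^ Suc n * (z / c))) \<longlonglongrightarrow> 1 / (1 - 0 * (z / c))"
    by (intro tendsto_intros LIMSEQ_Suc[OF qlim]) simp
  then have lim1: "(\<lambda>n. \<beta> (int n + 1)) \<longlonglongrightarrow> 1"
    by (simp add: \<beta>_def power_int_def nat_add_distrib)
  have "(\<lambda>n. q ^ n / (q ^ n - z / c)) \<longlonglongrightarrow> 0 / (0 - z / c)"
    using z0 c by (intro tendsto_intros qlim) auto
  moreover have "q ^ n / (q ^ n - z / c) = \<beta> (- int n)" for n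
  proof -
    have "1 - inverse (q ^ n) * (z / c) = (q ^ n - z / c) / q ^ n"
      using q by (simp add: diff_divide_distrib) (simp add: divide_inverse mult_ac)
    then show ?thesis by (simp add: \<beta>_def power_int_minus)
  qed
  ultimately have lim0: "(\<lambda>n. \<beta> (- int n)) \<longlonglongrightarrow> 0" by simp
  have "(\<lambda>n. \<beta> (- int n) - \<beta> (int n + 1)) \<longlonglongrightarrow> 0 - 1"
    by (intro tendsto_intros lim0 lim1)
  with lim_s have "s = - 1"
    unfolding tele using LIMSEQ_unique by fastforce
  then show ?thesis by (simp add: s_def q_def)
qed

lemma cnj_dipole: "cnj (dipole c t) = dipole (cnj c) (cnj t)"
  by (simp add: dipole_def)

lemma cnj_dipole_sum: "cnj (dipole_sum q c z) = dipole_sum (cnj q) (cnj c) (cnj z)"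
  by (simp add: dipole_sum_def cnj_dipole flip: infsum_cnj)

lemma off_poles_cnj:
  assumes "cnj q = q" "cnj c = c"
  shows "off_poles q c (cnj z) \<longleftrightarrow> off_poles q c z"
proof -
  have *: "cnj w = 1 \<longleftrightarrow> w = 1" for w
    by (simp add: complex_eq_iff)
  have "q powi k * cnj z = 1 \<longleftrightarrow> q powi k * z = 1"
    "c * (q powi k * cnj z) = 1 \<longleftrightarrow> c * (q powi k * z) = 1" for k
    using *[of "q powi k * z"] *[of "c * (q powi k * z)"] assms by simp_all
  then show ?thesis
    unfolding off_poles_def by simp
qed

lemma off_poles_times_half_period:
  assumes "c \<noteq> 0" "off_poles (c\<^sup>2) c z"
  shows "off_poles (c\<^sup>2) c (c * z)"
  unfolding off_poles_def
proof (intro conjI allI)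
  fix k :: int
  show "c\<^sup>2 powi k * (c * z) \<noteq> 1"
    using off_polesD(3)[OF assms(2), of k] by (simp add: mult_ac)
  have "c * (c\<^sup>2 powi k * (c * z)) = c\<^sup>2 powi (k + 1) * z"
    using assms(1) by (simp add: power_int_add power2_eq_square)
  then show "c * (c\<^sup>2 powi k * (c * z)) \<noteq> 1"
    using off_polesD(2)[OF assms(2)] by metis
qed (use assms off_polesD in auto)

text \<open>The factor \<open>\<i>\<close> and the additive constant are those that make the function real on the unit circle.\<close>
definition real_coord :: "complex \<Rightarrow> complex \<Rightarrow> complex" where
  "real_coord c z = \<i> * dipole_sum (c\<^sup>2) c z + \<i> / 2"

text \<open>The curve with \<open>q = c\<^sup>2\<close> and real \<open>c\<close> carries the real structure \<open>z \<mapsto> 1 / cnj z\<close>. Conjugation of the argument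
  composed with the involution \<open>z \<mapsto> 1 / (c z)\<close> gives \<open>1 / cnj z\<close> up to the half period \<open>c\<close>, which
  \<open>dipole_sum_half_period\<close> handles.\<close>
lemma cnj_real_coord:
  assumes c: "c \<noteq> 0" "norm c < 1" "cnj c = c" and z: "off_poles (c\<^sup>2) c z"
  shows "off_poles (c\<^sup>2) c (1 / cnj z)" "cnj (real_coord c z) = real_coord c (1 / cnj z)"
proof -
  have q: "c\<^sup>2 \<noteq> 0" "cnj (c\<^sup>2) = c\<^sup>2" using c by auto
  have off: "off_poles (c\<^sup>2) c (cnj z)"
    using z off_poles_cnj[OF q(2) c(3)] by blast
  have "off_poles (c\<^sup>2) c (c * (1 / (c * cnj z)))"
    by (rule off_poles_times_half_period[OF c(1)]) (use off off_poles_reflect[OF q(1) c(1)] in blast)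
  then show off': "off_poles (c\<^sup>2) c (1 / cnj z)" using c by simp
  have "dipole_sum (c\<^sup>2) c (1 / cnj z) + dipole_sum (c\<^sup>2) c (1 / (c * cnj z)) = - 1"
    using dipole_sum_half_period[OF c(1,2) off'] by (simp add: mult.commute)
  also have "dipole_sum (c\<^sup>2) c (1 / (c * cnj z)) = dipole_sum (c\<^sup>2) c (cnj z)"
    by (rule dipole_sum_reflect[OF q(1) c(1) off])
  also have "\<dots> = cnj (dipole_sum (c\<^sup>2) c z)"
    using q c by (simp add: cnj_dipole_sum)
  finally have "cnj (dipole_sum (c\<^sup>2) c z) = - 1 - dipole_sum (c\<^sup>2) c (1 / cnj z)"
    by (simp add: algebra_simps)
  then have "cnj (real_coord c z) = - \<i> * (- 1 - dipole_sum (c\<^sup>2) c (1 / cnj z)) - \<i> / 2"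
    by (simp add: real_coord_def)
  then show "cnj (real_coord c z) = real_coord c (1 / cnj z)"
    by (simp add: real_coord_def algebra_simps)
qed

lemma norm_1_inverse_cnj:
  assumes "norm z = 1"
  shows "1 / cnj z = z"
proof -
  have "z * cnj z = complex_of_real ((norm z)\<^sup>2)"
    by (rule complex_norm_square[symmetric])
  then have "z * cnj z = 1"
    unfolding assms by simp
  moreover have "cnj z \<noteq> 0"
    using assms by auto
  ultimately show ?thesis
    by (simp only: divide_eq_eq if_True not_False_eq_True)
qed

lemma off_poles_unit_circle:
  assumes c: "c \<noteq> 0" "norm c < 1" and z: "norm z = 1" "z \<noteq> 1"
  shows "off_poles (c\<^sup>2) c z"
proof -
  have c': "norm c \<noteq> 0" "norm (norm c) < 1" using c by auto
  have e: "(c\<^sup>2) powi k = c powi (2 * k)" for k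
    by (simp add: power_int_mult)
  show ?thesis
    unfolding off_poles_def e
  proof (intro conjI allI notI)
    fix k :: int
    show False if "c powi (2 * k) * z = 1"
    proof (cases "k = 0")
      case False
      have "norm c powi (2 * k) = 1"
        using arg_cong[OF that, of norm] z by (simp add: norm_mult norm_power_int)
      then show False using powi_neq_1[OF c', of "2 * k"] False by simp
    qed (use that z in auto)
    show False if "c * (c powi (2 * k) * z) = 1"
    proof -
      have "norm c powi (2 * k + 1) = 1"
        using arg_cong[OF that, of norm] z c by (simp add: norm_mult norm_power_int power_int_add mult.commute)
      moreover have "2 * k + 1 \<noteq> 0" by presburger
      ultimately show False using powi_neq_1[OF c', of "2 * k + 1"] by simp
    qed
  qed (use z in auto)
qed

lemma real_coord_real:
  assumes c: "c \<noteq> 0" "norm c < 1" "cnj c = c" and z: "norm z = 1" "z \<noteq> 1"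
  shows "real_coord c z \<in> \<real>"
  unfolding Reals_cnj_iff
  using cnj_real_coord(2)[OF c off_poles_unit_circle[OF c(1,2) z]] unfolding norm_1_inverse_cnj[OF z(1)] .

text \<open>Parametrize the unit circle without 1 by \<open>\<zeta> t = (2 t - \<i>) / (2 t + \<i>)\<close>, chosen such that the polar part
  \<open>\<i> / (1 - \<zeta> t)\<close> of the function is \<open>t + \<i> / 2\<close>. The function is then \<open>t\<close> plus a bounded
  continuous term, and the intermediate value theorem applies.\<close>
lemma real_coord_surj:
  assumes c: "c \<noteq> 0" "norm c < 1" "cnj c = c" and x: "x \<in> \<real>"
  obtains z where "norm z = 1" "z \<noteq> 1" "real_coord c z = x"
proof -
  have q: "c\<^sup>2 \<noteq> 0" "norm (c\<^sup>2) < 1"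
    using c by (auto simp: norm_power power_less_one_iff)
  have cq: "c * (c\<^sup>2) powi k \<noteq> 1" for k
  proof -
    have "c * (c\<^sup>2) powi k = c powi (2 * k + 1)"
      using c by (simp add: power_int_mult power_int_add)
    moreover have "c powi (2 * k + 1) \<noteq> 1"
      by (rule powi_neq_1[OF c(1,2)]) presburger
    ultimately show ?thesis by metis
  qed
  define E where "E = (\<lambda>z. dipole_sum (c\<^sup>2) c z - 1 / (1 - z))"
  have "isCont E z" if "norm z = 1" for z
  proof (cases "z = 1")
    case True
    then show ?thesis
      unfolding E_def using dipole_sum_pole_at_1[OF q c(1) cq] analytic_at_imp_isCont by blast
  next
    case False
    have "isCont (dipole_sum (c\<^sup>2) c) z"
      using dipole_sum_analytic[OF q c(1) off_poles_unit_circle[OF c(1,2) that False]] analytic_at_imp_isCont by blast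
    then show ?thesis unfolding E_def using False by (intro continuous_intros) auto
  qed
  then have E_cont: "continuous_on (sphere 0 1) E"
    by (intro continuous_at_imp_continuous_on) auto
  then have "bounded (E ` sphere 0 1)"
    by (intro compact_imp_bounded compact_continuous_image) auto
  then obtain M where "\<forall>y\<in>E ` sphere 0 1. norm y \<le> M"
    unfolding bounded_iff by blast
  then have M: "norm (E z) \<le> M" if "norm z = 1" for z
    using that by simp
  define \<zeta> where "\<zeta> = (\<lambda>t::real. (2 * complex_of_real t - \<i>) / (2 * complex_of_real t + \<i>))"
  have nz: "2 * complex_of_real t + \<i> \<noteq> 0" for t
    by (simp add: complex_eq_iff)
  have \<zeta>1: "norm (\<zeta> t) = 1" for t
  proof -
    have "2 * complex_of_real t - \<i> = cnj (2 * complex_of_real t + \<i>)" by simp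
    then have "norm (2 * complex_of_real t - \<i>) = norm (2 * complex_of_real t + \<i>)"
      by (metis complex_mod_cnj)
    then show ?thesis using nz[of t] by (simp add: \<zeta>_def norm_divide)
  qed
  have \<zeta>2: "\<zeta> t \<noteq> 1" for t
    using nz[of t] by (simp add: \<zeta>_def)
  have \<zeta>3: "1 / (1 - \<zeta> t) = 1 / 2 - \<i> * complex_of_real t" for t
  proof -
    have "1 - \<zeta> t = 2 * \<i> / (2 * complex_of_real t + \<i>)"
      using nz[of t] by (simp add: \<zeta>_def field_simps)
    then have "1 / (1 - \<zeta> t) = (2 * complex_of_real t + \<i>) / (2 * \<i>)"
      by simp
    also have "\<dots> = 1 / 2 - \<i> * complex_of_real t"
      by (subst nonzero_divide_eq_eq) (simp_all add: complex_eq_iff)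
    finally show ?thesis .
  qed
  have X: "real_coord c (\<zeta> t) = complex_of_real t + \<i> * (1 + E (\<zeta> t))" for t
    by (simp add: real_coord_def E_def \<zeta>3 algebra_simps)
  define \<phi> where "\<phi> = (\<lambda>t. t - Im (E (\<zeta> t)))"
  have \<phi>: "real_coord c (\<zeta> t) = complex_of_real (\<phi> t)" for t
  proof -
    have "real_coord c (\<zeta> t) = complex_of_real (Re (real_coord c (\<zeta> t)))"
      using real_coord_real[OF c \<zeta>1 \<zeta>2] by (simp add: complex_is_Real_iff complex_eq_iff)
    then show ?thesis by (simp add: X \<phi>_def)
  qed
  have cont: "continuous_on A \<phi>" for A
    unfolding \<phi>_def
    by (intro continuous_intros continuous_on_compose2[OF E_cont])
       (use nz \<zeta>1 in \<open>auto simp: \<zeta>_def intro!: continuous_intros\<close>)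
  obtain y where y: "x = complex_of_real y" using x by (auto elim: Reals_cases)
  have M': "\<bar>Im (E (\<zeta> t))\<bar> \<le> M" for t
    using M[OF \<zeta>1] abs_Im_le_cmod order_trans by blast
  have "M \<ge> 0" using M'[of 0] by linarith
  have "\<phi> (y - M) \<le> y" "y \<le> \<phi> (y + M)"
    using M'[of "y - M"] M'[of "y + M"] by (auto simp: \<phi>_def abs_le_iff)
  then obtain t where "\<phi> t = y"
    using IVT'[of \<phi> "y - M" y "y + M"] cont \<open>M \<ge> 0\<close> by auto
  then show ?thesis
    using \<phi>[of t] \<zeta>1 \<zeta>2 y by (intro that[of "\<zeta> t"]) auto
qed

section \<open>A torsion subgroup that conjugation does not preserve\<close>

text \<open>The curve is \<open>\<complex>\<^sup>* / c\<^bsup>2\<int>\<^esup>\<close>, and its \<open>l\<close>-torsion is generated by \<open>gam\<close> and \<open>eps\<close>. The absolute values of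
  \<open>gam\<close> and \<open>c\<^sup>2\<close> are even powers of \<open>1 / 2\<close> and that of \<open>c\<close> is an odd one; most arguments below compare these
  exponents.\<close>
locale torsion_subgroup =
  fixes m :: nat
  assumes m: "m \<ge> 1"
begin

definition l :: nat where "l = 2 * m + 1"
definition eps :: complex where "eps = cis (2 * pi / real l)"
definition gam :: complex where "gam = eps / 4"
definition c :: complex where "c = (1 / 2) ^ l"

lemma norm_eps: "norm eps = 1"
  by (simp add: eps_def)

lemma nonzero: "eps \<noteq> 0" "gam \<noteq> 0" "c \<noteq> 0"
  using norm_eps by (auto simp: gam_def c_def)

lemma eps_powi_eq_1_iff: "eps powi k = 1 \<longleftrightarrow> int l dvd k"
proof
  assume "eps powi k = 1"
  then have "cis (of_int k * (2 * pi / real l)) = 1"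
    by (simp only: eps_def cis_power_int)
  then have "exp (\<i> * complex_of_real (of_int k * (2 * pi / real l))) = 1"
    by (simp only: cis_conv_exp)
  then obtain n :: int where "of_int k * (2 * pi / real l) = of_int (2 * n) * pi"
    unfolding exp_eq_1 by auto
  moreover have "real l \<noteq> 0" by (simp add: l_def)
  ultimately have "of_int k * (2 * pi) = (real l * of_int n) * (2 * pi)"
    by (simp add: field_simps)
  then have "of_int k = real l * of_int n"
    using pi_neq_zero by (simp only: mult_cancel_right mult_eq_0_iff) auto
  then have "k = int l * n"
    by (metis of_int_eq_iff of_int_mult of_int_of_nat_eq)
  then show "int l dvd k" by simp
next
  assume "int l dvd k"
  then obtain n where "k = int l * n" by auto
  then have "of_int k * (2 * pi / real l) = 2 * pi * of_int n"
    by (simp add: l_def)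
  then show "eps powi k = 1"
    by (simp add: eps_def cis_power_int)
qed

lemma eps_pow_l: "eps ^ l = 1"
  using eps_powi_eq_1_iff[of "int l"] by simp

lemma gam_pow_l: "gam ^ l = c\<^sup>2"
proof -
  have "(1 / 4 :: complex) ^ l = ((1 / 2)\<^sup>2) ^ l" by (simp add: power2_eq_square)
  also have "\<dots> = c\<^sup>2"
    by (simp only: c_def power_mult[symmetric] mult.commute)
  finally have "(1 / 4 :: complex) ^ l = c\<^sup>2" .
  then show ?thesis by (simp add: gam_def power_divide eps_pow_l)
qed

lemma cnj_c: "cnj c = c" by (simp add: c_def)

lemma norm_powi:
  "norm (gam powi j) = (1 / 2) powi (2 * j)" "norm (c powi i) = (1 / 2) powi (int l * i)"
  "norm (c\<^sup>2 powi k) = (1 / 2) powi (2 * int l * k)" "norm (eps powi n) = 1"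
proof -
  have 4: "(1 / 4 :: real) = (1 / 2) powi 2" by (simp add: power2_eq_square)
  show "norm (gam powi j) = (1 / 2) powi (2 * j)"
    unfolding power_int_mult 4[symmetric] by (simp add: norm_power_int gam_def norm_divide norm_eps)
  show c: "norm (c powi i) = (1 / 2) powi (int l * i)" for i
    unfolding power_int_mult by (simp add: norm_power_int c_def norm_power norm_divide)
  have "c\<^sup>2 powi k = c powi (2 * k)" by (simp add: power_int_mult)
  then show "norm (c\<^sup>2 powi k) = (1 / 2) powi (2 * int l * k)"
    by (simp add: c mult_ac)
  show "norm (eps powi n) = 1" by (simp add: norm_power_int norm_eps)
qed

lemma norm_less_1: "norm gam < 1" "norm c < 1" "norm (c\<^sup>2) < 1"
proof -
  show "norm gam < 1" by (simp add: gam_def norm_divide norm_eps)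
  show "norm c < 1" unfolding c_def norm_power by (rule power_less_one_iff[THEN iffD2]) (auto simp: l_def)
  then show "norm (c\<^sup>2) < 1" by (simp add: norm_power power_less_one_iff)
qed

lemma half_powi_eq_1: "(1 / 2 :: real) powi n = 1 \<longleftrightarrow> n = 0"
  using powi_neq_1[of "1 / 2 :: real" n] by auto

lemma norm_product:
  assumes "norm z = 1"
  shows "norm (c powi i * (c\<^sup>2 powi k * (gam powi j * z))) = (1 / 2) powi (int l * i + 2 * int l * k + 2 * j)"
  using assms by (simp add: norm_mult norm_powi power_int_add)

lemma product_eq_1_imp:
  assumes "norm z = 1" "c powi i * (c\<^sup>2 powi k * (gam powi j * z)) = 1"
  shows "int l * (i + 2 * k) + 2 * j = 0"
  using norm_product[OF assms(1), of i k j] half_powi_eq_1[of "int l * i + 2 * int l * k + 2 * j"] assms(2)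
  by (simp add: algebra_simps)

lemma odd_l: "odd (int l)" by (simp add: l_def)

text \<open>The absolute value is an odd power of \<open>1 / 2\<close>.\<close>
lemma odd_product_neq_1:
  assumes "norm z = 1"
  shows "c * (c\<^sup>2 powi k * (gam powi j * z)) \<noteq> 1"
proof
  assume "c * (c\<^sup>2 powi k * (gam powi j * z)) = 1"
  then have "int l * (1 + 2 * k) + 2 * j = 0"
    using product_eq_1_imp[OF assms, of 1 k j] by simp
  moreover have "odd (int l * (1 + 2 * k) + 2 * j)" using odd_l by simp
  ultimately show False by simp
qed

lemma small_multiple:
  assumes "\<bar>j\<bar> < int l" "int l * k + j = 0"
  shows "j = 0 \<and> k = 0"
proof -
  have "int l dvd j"
    using assms(2) by (intro dvdI[of _ _ "-k"]) simp
  then have "j = 0" using assms(1) dvd_imp_le_int[of j "int l"] by fastforce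
  then show ?thesis using assms(2) by (simp add: l_def)
qed

lemma even_product_eq_1_imp:
  assumes "norm z = 1" "\<bar>j\<bar> < int l" "c\<^sup>2 powi k * (gam powi j * z) = 1"
  shows "j = 0" "k = 0" "z = 1"
proof -
  have "int l * k + j = 0"
    using product_eq_1_imp[OF assms(1), of 0 k j] assms(3) by (simp add: algebra_simps)
  then show "j = 0" "k = 0" using small_multiple[OF assms(2)] by auto
  then show "z = 1" using assms(3) by simp
qed

lemma off_poles_translate:
  assumes "norm z = 1" "z \<noteq> 1" "\<bar>j\<bar> < int l"
  shows "off_poles (c\<^sup>2) c (gam powi j * z)"
  unfolding off_poles_def using assms even_product_eq_1_imp[of z j] odd_product_neq_1[of z] nonzero
  by (auto simp: power_int_eq_0_iff)

lemma gam_powi_times_eq_1_imp: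
  assumes "norm z = 1" "gam powi k * z = 1"
  shows "k = 0" "z = 1"
proof -
  have "2 * k = 0"
    using product_eq_1_imp[OF assms(1), of 0 0 k] assms(2) by simp
  then show "k = 0" by simp
  then show "z = 1" using assms(2) by simp
qed

lemma c_gam_neq_1: "norm z = 1 \<Longrightarrow> c * (gam powi k * z) \<noteq> 1"
  using odd_product_neq_1[of z 0 k] by simp

lemma off_poles_gam:
  assumes "norm z = 1" "z \<noteq> 1"
  shows "off_poles gam c z"
  unfolding off_poles_def using assms gam_powi_times_eq_1_imp(2)[of z] c_gam_neq_1[of z] by auto

definition X :: "complex \<Rightarrow> complex" where "X = real_coord c"
definition Y :: "complex \<Rightarrow> complex" where "Y = (\<lambda>z. \<i> * dipole_sum gam c z)"
definition poles_X :: "complex set" where "poles_X = (\<lambda>j. X (gam powi j)) ` ({-int m..int m} - {0})"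

text \<open>This is \<open>g\<close>: since \<open>gam ^ l = c\<^sup>2\<close>, the function \<open>Y\<close> of the quotient curve is the sum of the translates of the
  function of the original curve by the powers of \<open>gam\<close>.\<close>
lemma Y_rational_in_X:
  obtains \<kappa> r where "\<And>t. t \<in> poles_X \<Longrightarrow> r t \<noteq> 0" "card poles_X = 2 * m"
    "\<And>z. \<lbrakk>norm z = 1; z \<noteq> 1\<rbrakk> \<Longrightarrow> X z \<notin> poles_X \<and> Y z = X z + \<kappa> + (\<Sum>t\<in>poles_X. r t / (X z - t))"
proof -
  have X: "X = (\<lambda>z. \<i> * dipole_sum (c\<^sup>2) c z + \<i> / 2)"
    by (simp add: X_def real_coord_def fun_eq_iff)
  have q: "c\<^sup>2 \<noteq> 0" "norm (c\<^sup>2) < 1" using nonzero norm_less_1 by auto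
  have 1: "gam powi j \<noteq> c\<^sup>2 powi k" if "j \<noteq> 0" "\<bar>j\<bar> \<le> 2 * int m" for j k
  proof
    assume "gam powi j = c\<^sup>2 powi k"
    then have "c\<^sup>2 powi (-k) * (gam powi j * 1) = 1"
      using q by (simp add: power_int_minus)
    then have "j = 0" by (rule even_product_eq_1_imp(1)[rotated 2]) (use that in \<open>auto simp: l_def\<close>)
    with that show False by simp
  qed
  have 2: "c * gam powi j * c\<^sup>2 powi k \<noteq> 1" for j k
    using odd_product_neq_1[of 1 k j] by (simp add: mult_ac)
  obtain \<kappa> r where r: "\<And>t. t \<in> poles_X \<Longrightarrow> r t \<noteq> 0" "card poles_X = 2 * m"
    "\<And>z. (\<And>j. \<bar>j\<bar> \<le> int m \<Longrightarrow> off_poles (c\<^sup>2) c (gam powi j * z)) \<Longrightarrow>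
      X z \<notin> poles_X \<and> \<i> * (\<Sum>j=-int m..int m. dipole_sum (c\<^sup>2) c (gam powi j * z)) = X z + \<kappa> + (\<Sum>t\<in>poles_X. r t / (X z - t))"
    unfolding poles_X_def X
    by (rule dipole_sum_partial_fractions[OF q nonzero(3,2) 1 2, of m \<i> "\<i> / 2"]) auto
  show ?thesis
  proof (rule that[OF r(1,2)])
    fix z :: complex assume z: "norm z = 1" "z \<noteq> 1"
    have "(\<Sum>j=-int m..int m. dipole_sum (gam ^ (2 * m + 1)) c (gam powi j * z)) = dipole_sum gam c z"
      by (rule dipole_sum_refine) (use nonzero norm_less_1 z in auto)
    then have "(\<Sum>j=-int m..int m. dipole_sum (c\<^sup>2) c (gam powi j * z)) = dipole_sum gam c z"
      using gam_pow_l by (simp add: l_def)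
    moreover have "off_poles (c\<^sup>2) c (gam powi j * z)" if "\<bar>j\<bar> \<le> int m" for j
      by (rule off_poles_translate[OF z]) (use that in \<open>simp add: l_def\<close>)
    ultimately show "X z \<notin> poles_X \<and> Y z = X z + \<kappa> + (\<Sum>t\<in>poles_X. r t / (X z - t))"
      using r(3)[of z] by (simp add: Y_def)
  qed
qed

definition poles_Y :: "complex set" where "poles_Y = (\<lambda>j. Y (eps powi j)) ` ({-int m..int m} - {0})"
definition H :: "complex \<Rightarrow> complex" where
  "H z = (\<Sum>k=-int m..int m. \<Sum>j=-int m..int m. X (gam powi j * (eps powi k * z)))"

lemma dipole_sum_gam: "z \<noteq> 0 \<Longrightarrow> (\<Sum>j=-int m..int m. dipole_sum (c\<^sup>2) c (gam powi j * z)) = dipole_sum gam c z"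
  using dipole_sum_refine[OF nonzero(2) norm_less_1(1) nonzero(3), of z m] gam_pow_l by (simp add: l_def)

lemma eps_powi_times_neq_1: "z ^ l \<noteq> 1 \<Longrightarrow> eps powi k * z \<noteq> 1"
proof
  assume z: "z ^ l \<noteq> 1" "eps powi k * z = 1"
  have "(eps powi k) ^ l = (eps ^ l) powi k"
    by (metis power_int_mult mult.commute power_int_of_nat)
  then have "(eps powi k * z) ^ l = z ^ l"
    by (simp add: power_mult_distrib eps_pow_l)
  with z show False by simp
qed

text \<open>This is \<open>f\<close>: the group generated by \<open>gam\<close> and \<open>eps\<close> contains the full \<open>l\<close>-torsion, so a further
  sum over the powers of \<open>eps\<close> gives the function \<open>H\<close> of the quotient by that torsion.\<close>
lemma H_rational_in_Y:
  obtains \<kappa> r where "\<And>t. t \<in> poles_Y \<Longrightarrow> r t \<noteq> 0" "card poles_Y = 2 * m"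
    "\<And>z. \<lbrakk>norm z = 1; z ^ l \<noteq> 1\<rbrakk> \<Longrightarrow> Y z \<notin> poles_Y \<and> H z = Y z + \<kappa> + (\<Sum>t\<in>poles_Y. r t / (Y z - t))"
proof -
  have Y: "Y = (\<lambda>z. \<i> * dipole_sum gam c z + 0)"
    by (simp add: Y_def)
  have 1: "eps powi j \<noteq> gam powi k" if "j \<noteq> 0" "\<bar>j\<bar> \<le> 2 * int m" for j k
  proof
    assume "eps powi j = gam powi k"
    then have "gam powi (-k) * eps powi j = 1"
      using nonzero by (simp add: power_int_minus)
    then have "eps powi j = 1"
      by (rule gam_powi_times_eq_1_imp(2)[rotated]) (simp add: norm_powi)
    then have "int l dvd j" by (simp add: eps_powi_eq_1_iff)
    then have "int l \<le> \<bar>j\<bar>" using dvd_imp_le_int[OF that(1)] by fastforce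
    with that(2) show False by (simp add: l_def)
  qed
  have 2: "c * eps powi j * gam powi k \<noteq> 1" for j k
    using c_gam_neq_1[of "eps powi j" k] by (simp add: norm_powi mult_ac)
  obtain \<kappa> r where r: "\<And>t. t \<in> poles_Y \<Longrightarrow> r t \<noteq> 0" "card poles_Y = 2 * m"
    "\<And>z. (\<And>j. \<bar>j\<bar> \<le> int m \<Longrightarrow> off_poles gam c (eps powi j * z)) \<Longrightarrow>
      Y z \<notin> poles_Y \<and> \<i> * (\<Sum>j=-int m..int m. dipole_sum gam c (eps powi j * z)) = Y z + \<kappa> + (\<Sum>t\<in>poles_Y. r t / (Y z - t))"
    unfolding poles_Y_def Y
    by (rule dipole_sum_partial_fractions[OF nonzero(2) norm_less_1(1) nonzero(3,1) 1 2, of m \<i> 0]) auto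
  \<comment> \<open>the additive constants of the real coordinates, which \<open>\<kappa>\<close> absorbs\<close>
  define N where "N = (\<Sum>k=-int m..int m. \<Sum>j=-int m..int m. \<i> / 2)"
  show ?thesis
  proof (rule that[OF r(1,2)])
    fix z :: complex assume z: "norm z = 1" "z ^ l \<noteq> 1"
    have "off_poles gam c (eps powi j * z)" for j
      by (rule off_poles_gam) (use z eps_powi_times_neq_1[OF z(2)] in \<open>simp_all add: norm_mult norm_powi\<close>)
    then have *: "Y z \<notin> poles_Y \<and> \<i> * (\<Sum>j=-int m..int m. dipole_sum gam c (eps powi j * z))
        = Y z + \<kappa> + (\<Sum>t\<in>poles_Y. r t / (Y z - t))"
      using r(3)[of z] by blast
    have z0: "eps powi k * z \<noteq> 0" for k using z nonzero by auto
    have "H z = (\<Sum>k=-int m..int m. \<Sum>j=-int m..int m. \<i> * dipole_sum (c\<^sup>2) c (gam powi j * (eps powi k * z))) + N"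
      unfolding H_def N_def X_def real_coord_def by (simp only: sum.distrib)
    also have "\<dots> = (\<Sum>k=-int m..int m. \<i> * dipole_sum gam c (eps powi k * z)) + N"
      by (simp only: dipole_sum_gam[OF z0] sum_distrib_left[symmetric])
    also have "\<dots> = \<i> * (\<Sum>k=-int m..int m. dipole_sum gam c (eps powi k * z)) + N"
      by (simp only: sum_distrib_left)
    finally show "Y z \<notin> poles_Y \<and> H z = Y z + (\<kappa> + N) + (\<Sum>t\<in>poles_Y. r t / (Y z - t))"
      using * by simp
  qed
qed

lemma inverse_cnj_gam: "1 / cnj gam = eps\<^sup>2 * gam powi (-1)"
proof -
  have "1 / cnj gam = 4 * (1 / cnj eps)"
    by (simp add: gam_def)
  also have "\<dots> = 4 * eps"
    by (simp only: norm_1_inverse_cnj[OF norm_eps])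
  also have "\<dots> = eps\<^sup>2 * gam powi (-1)"
    using nonzero(1) by (simp add: gam_def power_int_minus power2_eq_square)
  finally show ?thesis .
qed

text \<open>The reflection \<open>z \<mapsto> 1 / cnj z\<close> maps \<open>gam\<close> to \<open>eps\<^sup>2 / gam\<close> and fixes \<open>eps\<close>. So it permutes the \<open>l\<close>-torsion,
  over which \<open>H\<close> is a sum.\<close>
lemma H_real:
  assumes z: "norm z = 1" "z ^ l \<noteq> 1"
  shows "H z \<in> \<real>"
proof -
  have reflect: "1 / cnj (gam powi j * (eps powi k * z)) = gam powi (-j) * (eps powi (2 * j + k) * z)" for j k
  proof -
    have "1 / cnj (gam powi j * (eps powi k * z)) = (1 / cnj gam) powi j * ((1 / cnj eps) powi k * (1 / cnj z))"
      by (simp add: power_int_divide_distrib)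
    also have "1 / cnj eps = eps" by (rule norm_1_inverse_cnj[OF norm_eps])
    also have "1 / cnj z = z" by (rule norm_1_inverse_cnj[OF z(1)])
    also have "(1 / cnj gam) powi j = eps powi (2 * j) * gam powi (-j)"
      by (simp add: inverse_cnj_gam power_int_mult_distrib power_int_mult power_int_minus power_int_inverse)
    finally show ?thesis using nonzero by (simp add: power_int_add mult_ac)
  qed
  have off: "off_poles (c\<^sup>2) c (gam powi j * (eps powi k * z))" if "j \<in> {-int m..int m}" for j k
  proof (rule off_poles_translate)
    show "norm (eps powi k * z) = 1" by (simp add: norm_mult norm_powi z)
    show "eps powi k * z \<noteq> 1" by (rule eps_powi_times_neq_1[OF z(2)])
    show "\<bar>j\<bar> < int l" using that by (auto simp: l_def abs_less_iff)
  qed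
  define F where "F = (\<lambda>j k. X (gam powi j * (eps powi k * z)))"
  have per: "F j (k + (2 * int m + 1)) = F j k" for j k
  proof -
    have "eps powi (2 * int m + 1) = 1"
      unfolding eps_powi_eq_1_iff by (simp add: l_def add.commute)
    then have "eps powi (k + (2 * int m + 1)) = eps powi k"
      by (subst power_int_add) (simp_all only: nonzero mult_1_right simp_thms)
    then show ?thesis by (simp only: F_def)
  qed
  have "cnj (F j k) = F (-j) (2 * j + k)" if "j \<in> {-int m..int m}" for j k
    unfolding F_def X_def cnj_real_coord(2)[OF nonzero(3) norm_less_1(2) cnj_c off[OF that]] reflect ..
  then have "cnj (\<Sum>k=-int m..int m. \<Sum>j=-int m..int m. F j k)
      = (\<Sum>k=-int m..int m. \<Sum>j=-int m..int m. F (-j) (2 * j + k))"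
    unfolding cnj_sum by (intro sum.cong refl) auto
  also have "\<dots> = (\<Sum>j=-int m..int m. \<Sum>k=-int m..int m. F (-j) (2 * j + k))"
    by (rule sum.swap)
  also have "\<dots> = (\<Sum>j=-int m..int m. \<Sum>k=-int m..int m. F (-j) k)"
    by (intro sum.cong refl sum_shift_periodic per)
  also have "\<dots> = (\<Sum>j=-int m..int m. \<Sum>k=-int m..int m. F j k)"
    by (rule sum_symmetric_int[where f = "\<lambda>j. \<Sum>k=-int m..int m. F j k"])
  also have "\<dots> = (\<Sum>k=-int m..int m. \<Sum>j=-int m..int m. F j k)"
    by (rule sum.swap)
  finally show ?thesis by (simp add: Reals_cnj_iff H_def F_def)
qed

text \<open>Two points with the same value have a power of \<open>gam\<close> as quotient, or a power of \<open>gam\<close> divided by \<open>c\<close> as product. On the unit circle the second is excluded by parity, and the first leaves only the exponent 0.\<close>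
lemma inj_Y: "inj_on Y (sphere 0 1 - {1})"
proof (rule inj_onI)
  fix z w assume zw: "z \<in> sphere 0 1 - {1}" "w \<in> sphere 0 1 - {1}" "Y z = Y w"
  then have n: "norm z = 1" "norm w = 1" "z \<noteq> 1" "w \<noteq> 1" by auto
  have 1: "c * gam powi k \<noteq> 1" for k using c_gam_neq_1[of 1 k] by simp
  have 2: "c * w\<^sup>2 * gam powi k \<noteq> 1" for k
    using c_gam_neq_1[of "w\<^sup>2" k] n by (simp add: norm_power mult_ac)
  have "dipole_sum gam c z = dipole_sum gam c w" using zw(3) by (simp add: Y_def)
  then consider k where "z = gam powi k * w" | k where "z = gam powi k * (1 / (c * w))"
    using dipole_sum_eq_imp_orbit[OF nonzero(2) norm_less_1(1) nonzero(3) 1 off_poles_gam[OF n(2,4)] 2 off_poles_gam[OF n(1,3)]]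
    by metis
  then show "z = w"
  proof cases
    case (1 k)
    have "gam powi k * (w / z) = (gam powi k * w) / z" by simp
    also have "\<dots> = 1" unfolding 1[symmetric] using n by auto
    finally have "gam powi k * (w / z) = 1" .
    moreover have "norm (w / z) = 1" using n by (simp add: norm_divide)
    ultimately have "w / z = 1" using gam_powi_times_eq_1_imp(2) by blast
    then show ?thesis by auto
  next
    case (2 k)
    then have "c * (gam powi (-k) * (z * w)) = 1"
      using nonzero n by (auto simp: power_int_minus)
    moreover have "norm (z * w) = 1" using n by (simp add: norm_mult)
    ultimately show ?thesis using c_gam_neq_1 by blast
  qed
qed

lemma continuous_Y: "continuous_on (sphere 0 1 - {1}) Y"
proof (rule continuous_at_imp_continuous_on, rule ballI)
  fix z :: complex assume "z \<in> sphere 0 1 - {1}"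
  then have "dipole_sum gam c analytic_on {z}"
    by (intro dipole_sum_analytic nonzero norm_less_1 off_poles_gam) auto
  then show "isCont Y z"
    unfolding Y_def using analytic_at_imp_isCont by (intro continuous_intros) blast
qed

lemma filterlim_Y: "filterlim Y at_infinity (at 1)"
proof -
  have 1: "c * gam powi k \<noteq> 1" for k using c_gam_neq_1[of 1 k] by simp
  have "((\<lambda>z. \<i> * ((z - 1) * dipole_sum gam c z)) \<longlongrightarrow> \<i> * - 1) (at 1)"
    by (intro tendsto_intros dipole_sum_pole_at_1_residue nonzero norm_less_1 1)
  moreover have "filterlim (\<lambda>z::complex. z - 1) (at 0) (at 1)"
    by (rule filterlim_atI) (auto intro!: tendsto_eq_intros simp: eventually_at_filter)
  ultimately have "filterlim (\<lambda>z. \<i> * ((z - 1) * dipole_sum gam c z) / (z - 1)) at_infinity (at 1)"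
    by (rule filterlim_divide_at_infinity) simp
  moreover have "\<forall>\<^sub>F z in at 1. \<i> * ((z - 1) * dipole_sum gam c z) / (z - 1) = Y z"
    using eventually_neq_at_within[of 1 1] by eventually_elim (simp add: Y_def)
  ultimately show ?thesis by (simp cong: filterlim_cong add: filterlim_cong)
qed

text \<open>The conjugate of \<open>X gam\<close> is \<open>X (eps\<^sup>2 / gam)\<close>. It could equal \<open>X (gam\<^sup>j)\<close> only for \<open>j = - 1\<close>, by absolute
  values, and then \<open>eps\<^sup>2 = 1\<close>. In other words, the subgroup generated by \<open>gam\<close> is not stable under conjugation.\<close>
lemma poles_X_not_closed_under_cnj: "\<exists>t\<in>poles_X. cnj t \<notin> poles_X"
proof (rule bexI)
  show "X gam \<in> poles_X"
    using m by (auto simp: poles_X_def intro!: image_eqI[of _ _ 1])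
  have q: "c\<^sup>2 \<noteq> 0" "norm (c\<^sup>2) < 1" using nonzero norm_less_1 by auto
  have cq: "c * c\<^sup>2 powi k \<noteq> 1" for k using odd_product_neq_1[of 1 k 0] by simp
  have off: "off_poles (c\<^sup>2) c (gam powi j)" if "j \<noteq> 0" "\<bar>j\<bar> < int l" for j
    unfolding off_poles_def
    using even_product_eq_1_imp(1)[of 1 j] odd_product_neq_1[of 1 _ j] that nonzero by auto
  have off_gam: "off_poles (c\<^sup>2) c gam" using off[of 1] m by (simp add: l_def)
  note refl = cnj_real_coord[OF nonzero(3) norm_less_1(2) cnj_c off_gam, folded X_def]
  show "cnj (X gam) \<notin> poles_X"
  proof
    assume "cnj (X gam) \<in> poles_X"
    then obtain j where "j \<in> {-int m..int m} - {0}" and jX: "X (1 / cnj gam) = X (gam powi j)"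
      unfolding refl poles_X_def by blast
    then have j: "j \<noteq> 0" "\<bar>j\<bar> \<le> int m" by auto
    from jX have "dipole_sum (c\<^sup>2) c (1 / cnj gam) = dipole_sum (c\<^sup>2) c (gam powi j)"
      by (simp add: X_def real_coord_def)
    moreover have "\<bar>j\<bar> < int l" using j by (simp add: l_def)
    moreover have "c * (gam powi j)\<^sup>2 * c\<^sup>2 powi k \<noteq> 1" for k
      using odd_product_neq_1[of 1 k "j * 2"] by (simp add: power_int_mult mult_ac)
    ultimately consider k where "1 / cnj gam = c\<^sup>2 powi k * gam powi j"
      | k where "1 / cnj gam = c\<^sup>2 powi k * (1 / (c * gam powi j))"
      using dipole_sum_eq_imp_orbit[OF q nonzero(3) cq off[OF j(1)] _ refl(1)] by metis
    then show False
    proof cases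
      case (1 k)
      have "c\<^sup>2 powi k * (gam powi (j + 1) * inverse (eps\<^sup>2)) = 1"
        using 1 nonzero by (simp add: inverse_cnj_gam power_int_add power_int_minus field_simps)
      moreover have "norm (inverse (eps\<^sup>2)) = 1" by (simp add: norm_inverse norm_power norm_eps)
      moreover have "\<bar>j + 1\<bar> < int l" using j m by (simp add: l_def)
      ultimately have "inverse (eps\<^sup>2) = 1" by (rule even_product_eq_1_imp(3)[rotated 2])
      then have "eps powi 2 = 1" by (simp add: inverse_eq_1_iff)
      then have "int l dvd 2" by (simp only: eps_powi_eq_1_iff)
      then have "int l \<le> 2" by (rule zdvd_imp_le) simp
      then show False using m by (simp add: l_def)
    next
      case (2 k)
      have "c * (c\<^sup>2 powi (-k) * (gam powi (j - 1) * eps\<^sup>2)) = 1"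
        using 2 nonzero by (simp add: inverse_cnj_gam power_int_diff power_int_minus field_simps)
      moreover have "norm (eps\<^sup>2) = 1" by (simp add: norm_power norm_eps)
      ultimately show False using odd_product_neq_1 by blast
    qed
  qed
qed

end

section \<open>The rational functions\<close>

lemma (in torsion_subgroup) image_X: "X ` (sphere 0 1 - {1}) = \<real>"
proof -
  have "X ` (sphere 0 1 - {1}) \<subseteq> \<real>"
    unfolding X_def by (auto intro!: real_coord_real nonzero norm_less_1 cnj_c)
  moreover have "x \<in> X ` (sphere 0 1 - {1})" if x: "x \<in> \<real>" for x
  proof -
    obtain z where "norm z = 1" "z \<noteq> 1" "real_coord c z = x"
      by (rule real_coord_surj[OF nonzero(3) norm_less_1(2) cnj_c x])
    then show ?thesis unfolding X_def by (intro image_eqI[of _ _ z]) auto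
  qed
  ultimately show ?thesis by blast
qed

text \<open>The coordinate \<open>X\<close> parametrizes the real circle by the unit circle, where the point 1 corresponds to infinity. All properties of
  \<open>g\<close> on the real circle are thereby properties of \<open>Y\<close> on the unit circle.\<close>
lemma (in torsion_subgroup) real_circle_eq: "real_circle = insert None (Some ` X ` (sphere 0 1 - {1}))"
  by (simp add: real_circle_def image_X)

lemma (in torsion_subgroup) exists_jordan_curve:
  "\<exists>f g :: complex poly fract.
    ratfun_degree f = l \<and> ratfun_degree g = l \<and>
    (\<exists>h\<in>real_ratfuns. ratfun_map f \<circ> ratfun_map g = ratfun_map h) \<and>
    (inj_on (ratfun_map g) real_circle \<and>
      jordan_curve_in_sphere (ratfun_map g ` real_circle)) \<and>
    \<not> circle_in_sphere (ratfun_map g ` real_circle)"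
proof -
  let ?C = "sphere (0::complex) 1 - {1}"
  obtain \<kappa> r where r: "\<And>t. t \<in> poles_X \<Longrightarrow> r t \<noteq> 0" and card_X: "card poles_X = 2 * m"
    and Y_eq: "\<And>z. \<lbrakk>norm z = 1; z \<noteq> 1\<rbrakk> \<Longrightarrow>
      X z \<notin> poles_X \<and> Y z = X z + \<kappa> + (\<Sum>t\<in>poles_X. r t / (X z - t))"
    by (rule Y_rational_in_X) blast
  obtain \<kappa>' r' where r': "\<And>t. t \<in> poles_Y \<Longrightarrow> r' t \<noteq> 0" and card_Y: "card poles_Y = 2 * m"
    and H_eq: "\<And>z. \<lbrakk>norm z = 1; z ^ l \<noteq> 1\<rbrakk> \<Longrightarrow>
      Y z \<notin> poles_Y \<and> H z = Y z + \<kappa>' + (\<Sum>t\<in>poles_Y. r' t / (Y z - t))"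
    by (rule H_rational_in_Y) blast
  define p where "p = pf_num \<kappa> r poles_X"
  define q where "q = pf_den poles_X"
  define P where "P = pf_num \<kappa>' r' poles_Y"
  define Q where "Q = pf_den poles_Y"
  have fin: "finite poles_X" "finite poles_Y"
    by (simp_all add: poles_X_def poles_Y_def)
  have pq: "coprime p q" "q \<noteq> 0" "degree q < degree p"
    unfolding p_def q_def using fin r
    by (simp_all add: coprime_pf pf_den_nonzero degree_pf_den degree_pf_num)
  have PQ: "coprime P Q" "Q \<noteq> 0" "degree Q < degree P"
    unfolding P_def Q_def using fin r'
    by (simp_all add: coprime_pf pf_den_nonzero degree_pf_den degree_pf_num)
  define g where "g = Fract p q"
  define f where "f = Fract P Q"
  have g_at: "ratfun_map g (Some (X z)) = Some (Y z)" if "norm z = 1" "z \<noteq> 1" for z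
    unfolding g_def ratfun_map_Fract_Some[OF pq(1,2)]
    using Y_eq[OF that] fin poly_pf_num[of poles_X "X z" \<kappa> r] by (simp add: p_def q_def poly_pf_den)
  have f_at: "ratfun_map f (Some (Y z)) = Some (H z)" if "norm z = 1" "z ^ l \<noteq> 1" for z
    unfolding f_def ratfun_map_Fract_Some[OF PQ(1,2)]
    using H_eq[OF that] fin poly_pf_num[of poles_Y "Y z" \<kappa>' r'] by (simp add: P_def Q_def poly_pf_den)
  have g_None: "ratfun_map g None = None"
    unfolding g_def by (rule ratfun_map_Fract_None[OF pq])
  have img: "ratfun_map g ` real_circle = insert None (Some ` Y ` ?C)"
  proof -
    have "ratfun_map g ` Some ` X ` ?C = Some ` Y ` ?C"
      unfolding image_image by (intro image_cong refl g_at) auto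
    then show ?thesis unfolding real_circle_eq by (simp add: g_None del: ratfun_map.simps)
  qed
  have deg: "ratfun_degree f = l" "ratfun_degree g = l"
    unfolding f_def g_def ratfun_degree_Fract[OF PQ(1,2)] ratfun_degree_Fract[OF pq(1,2)]
    using fin card_X card_Y
    by (simp_all add: p_def q_def P_def Q_def degree_pf_num degree_pf_den l_def)
  have inj: "inj_on (ratfun_map g) real_circle"
    unfolding real_circle_eq
  proof (rule inj_onI)
    fix x y assume xy: "x \<in> insert None (Some ` X ` ?C)" "y \<in> insert None (Some ` X ` ?C)"
      and eq: "ratfun_map g x = ratfun_map g y"
    have *: "w = None \<or> (\<exists>z\<in>?C. w = Some (X z) \<and> ratfun_map g w = Some (Y z))"
      if "w \<in> insert None (Some ` X ` ?C)" for w
      using that g_at by fastforce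
    show "x = y"
      using *[OF xy(1)] *[OF xy(2)] eq g_None inj_onD[OF inj_Y] by fastforce
  qed
  have jordan: "jordan_curve_in_sphere (ratfun_map g ` real_circle)"
    unfolding img by (rule jordan_curve_through_infinity[OF continuous_Y inj_Y filterlim_Y])
  have not_circle: "\<not> circle_in_sphere (ratfun_map g ` real_circle)"
  proof
    assume circ: "circle_in_sphere (ratfun_map g ` real_circle)"
    \<comment> \<open>The image contains infinity, so only a line is possible.\<close>
    have "None \<in> ratfun_map g ` real_circle" by (simp add: img)
    with circ obtain a b where b: "b \<noteq> 0"
      and S: "ratfun_map g ` real_circle = insert None (Some ` {a + of_real t * b | t :: real. True})"
      unfolding circle_in_sphere_def by blast
    have line: "\<exists>t::real. poly p x / poly q x = a + of_real t * b" if x: "x \<in> \<real>" "poly q x \<noteq> 0" for x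
    proof -
      have "ratfun_map g (Some x) = Some (poly p x / poly q x)"
        unfolding g_def ratfun_map_Fract_Some[OF pq(1,2)] using x by simp
      moreover have "ratfun_map g (Some x) \<in> ratfun_map g ` real_circle"
        using x by (intro imageI) (simp add: real_circle_def)
      ultimately show ?thesis unfolding S by auto
    qed
    obtain t where t: "t \<in> poles_X" "cnj t \<notin> poles_X"
      using poles_X_not_closed_under_cnj by blast
    then have "poly q t = 0" "poly q (cnj t) \<noteq> 0"
      using fin by (simp_all add: q_def poly_pf_den)
    then show False
      using roots_closed_under_cnj_if_line[OF pq(1,2) b line] by blast
  qed
  define A where "A = homogenize (degree P) P p q"
  define B where "B = homogenize (degree P) Q p q"
  have AB: "ratfun_map f \<circ> ratfun_map g = ratfun_map (Fract A B)" "B \<noteq> 0" "coprime A B"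
    unfolding f_def g_def A_def B_def using ratfun_map_comp_Fract[OF PQ pq] by simp_all
  have "Fract A B \<in> real_ratfuns"
  proof (rule Fract_real_if_real_values[OF AB(2)])
    let ?G = "{z::complex. norm z = 1 \<and> z ^ l \<noteq> 1}"
    have fin_roots: "finite {z::complex. z ^ l = 1}"
      by (rule finite_roots_unity) (simp add: l_def)
    have inf_C: "infinite (X ` ?C)"
    proof
      assume "finite (X ` ?C)"
      then have "finite (range complex_of_real)" by (simp add: image_X Reals_def)
      then show False
        using infinite_UNIV_char_0[where 'a = real] by (simp add: finite_image_iff inj_of_real)
    qed
    have cover: "X ` ?C \<subseteq> X ` ?G \<union> X ` {z. z ^ l = 1}" by auto
    show "infinite (X ` ?G)"
    proof
      assume "finite (X ` ?G)"
      then have "finite (X ` ?G \<union> X ` {z. z ^ l = 1})"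
        using fin_roots by simp
      then show False
        using inf_C finite_subset[OF cover] by blast
    qed
    show "X ` ?G \<subseteq> \<real>"
      unfolding X_def by (auto intro!: real_coord_real nonzero norm_less_1 cnj_c)
    fix x assume "x \<in> X ` ?G"
    then obtain z where z: "x = X z" "norm z = 1" "z ^ l \<noteq> 1" by blast
    then have "z \<noteq> 1" by auto
    have "ratfun_map (Fract A B) (Some x) = Some (H z)"
      using g_at[OF z(2) \<open>z \<noteq> 1\<close>] f_at[OF z(2,3)] z(1) fun_cong[OF AB(1), of "Some x"]
      by (simp del: ratfun_map.simps)
    then have "poly B x \<noteq> 0" "poly A x / poly B x = H z"
      unfolding ratfun_map_Fract_Some[OF AB(3,2)] by (auto split: if_splits)
    then show "poly B x \<noteq> 0 \<and> poly A x / poly B x \<in> \<real>"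
      using H_real[OF z(2,3)] by simp
  qed
  with AB(1) deg inj jordan not_circle show ?thesis by blast
qed

theorem theorem1p2:
  fixes l :: nat
  assumes "prime l" and "odd l"
  shows "\<exists>f g :: complex poly fract.
    ratfun_degree f = l \<and> ratfun_degree g = l \<and>
    (\<exists>h\<in>real_ratfuns. ratfun_map f \<circ> ratfun_map g = ratfun_map h) \<and>
    (inj_on (ratfun_map g) real_circle \<and>
      jordan_curve_in_sphere (ratfun_map g ` real_circle)) \<and>
    \<not> circle_in_sphere (ratfun_map g ` real_circle)"
proof -
  obtain m where l_eq: "l = 2 * m + 1"
    using assms(2) by (elim oddE)
  from assms(1) have "m \<ge> 1"
    unfolding l_eq by (cases m) auto
  then interpret torsion_subgroup m
    by unfold_locales
  from exists_jordan_curve show ?thesis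
    unfolding l_def l_eq .
qed

end
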